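(* Let $\Gamma$ be an octal game, and let $d$ be the index of its last non-zero code digit. Fix $n_0 \geq 0$, and suppose that $(\mathcal{Q},\mathcal{P}) = \mathcal{Q}_{2n_0+d-1}(\Gamma)$ is faithfully normal with kernel $\mathcal{K}$, and that $\Phi(H_n) \in \mathcal{K}$ for all $n$ with $n_0 \leq n < 2n_0 + d$, where $\Phi$ is the quotient map onto $\mathcal{Q}_{2n_0+d-1}(\Gamma)$. Then: (i) $\mathcal{Q}(\Gamma)$ is faithfully normal; (ii) $\mathcal{Q}(\Gamma) \cong \mathcal{T}^k(\mathcal{Q},\mathcal{P})$ for some $k \in \mathbb{N}\cup\{\infty\}$; (iii) $\Phi_\Gamma(H_n) \in \ker \mathcal{Q}(\Gamma)$ for all $n \geq n_0$, where $\Phi_\Gamma$ is the quotient map onto $\mathcal{Q}(\Gamma)$.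
   Context: Impartial games are identified with finite sets of games (a game is the set of its options); $0=\emptyset$; $G+H$ has options $G'+H$ and $G+H'$. Misère play: $G$ is a $\mathscr{P}$-position iff $G\neq 0$ and every option is an $\mathscr{N}$-position. A set of games is closed if it contains $0$ and is closed under options and sums; $\mathrm{cl}(\mathscr{S})$ is the smallest closed set containing $\mathscr{S}$. For closed $\mathscr{A}$, $G\equiv_\mathscr{A} H$ iff $G+X$, $H+X$ have the same misère outcome for all $X\in\mathscr{A}$; $\mathcal{Q}(\mathscr{A})=\mathscr{A}/{\equiv_\mathscr{A}}$ is a commutative monoid with distinguished subset $\mathcal{P}$ (classes of $\mathscr{P}$-positions), and $\Phi:\mathscr{A}\to\mathcal{Q}(\mathscr{A})$ is the quotient map. For any set $\mathscr{S}$, $\mathcal{Q}(\mathscr{S}) := \mathcal{Q}(\mathrm{cl}(\mathscr{S}))$. Bipartite monoid: commutative monoid with a distinguished subset; isomorphisms preserve the subset. The kernel $\mathcal{K}$ of a commutative monoid is the intersection of all its ideals; when nonempty it is a group whose identity $z$ is the kernel identity. The Grundy value $\mathscr{G}(G)$ is the mex of the Grundy values of the options of $G$. The quotient (map) is faithful if $\Phi(G)=\Phi(H)$ implies $\mathscr{G}(G)=\mathscr{G}(H)$ for all $G,H\in\mathscr{A}$; it is normal if $\mathcal{K}\cap\mathcal{P}=\{z\}$; faithfully normal if both. Tame extension: for a bipartite monoid $(\mathcal{Q},\mathcal{P})$ with kernel $\mathcal{K}$, $\mathcal{T}(\mathcal{Q},\mathcal{P}) = (\mathcal{Q}^+,\mathcal{P}^+)$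 where $\mathcal{Q}^+ = \mathcal{Q}\cup\overline{\mathcal{K}}$, $\overline{\mathcal{K}} = \{\overline{x} : x\in\mathcal{K}\}$ a set of new formal symbols, $\mathcal{P}^+=\mathcal{P}$, and multiplication extends that of $\mathcal{Q}$ by $x\cdot\overline{y} = \overline{xy}$ ($x\in\mathcal{Q}$, $y\in\mathcal{K}$) and $\overline{x}\cdot\overline{y} = xy$ ($x,y\in\mathcal{K}$). $\mathcal{T}^0(\mathcal{Q},\mathcal{P})=(\mathcal{Q},\mathcal{P})$, $\mathcal{T}^{n+1} = \mathcal{T}(\mathcal{T}^n)$, and $\mathcal{T}^\infty(\mathcal{Q},\mathcal{P})$ is the union (direct limit) of the chain $\mathcal{T}^0\subseteq\mathcal{T}^1\subseteq\cdots$. Octal games: a code $d_0.d_1d_2\cdots d_k$ with each $d_j\in\{0,\ldots,7\}$ and $d_k\neq 0$; $k$ is the index of the last non-zero code digit. A position is a sum of heaps $H_n$ ($n$ tokens). A move chooses a heap of size $h$ and $j$ with $0\le j\le \min(k,h)$, removes $j$ tokens from it, and then: if $d_j$ has bit $1$ set and $j=h$, leaves nothing; if bit $2$ is set and $h-j\ge1$, leaves one heap of size $h-j$; if bit $4$ is set, leaves two nonempty heaps with total size $h-j$. Each $H_n$ is an impartial game. The partial quotient is $\mathcal{Q}_M(\Gamma) = \mathcal{Q}(\{H_0,\ldots,H_M\})$ and the quotient is $\mathcal{Q}(\Gamma)=\mathcal{Q}(\{H_n : n\ge 0\})$. *)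

theory Defs
  imports Main "HOL-Library.FSet" "HOL-Library.Extended_Nat" "HOL-Algebra.Group"
begin

section \<open>Impartial games\<close>

text \<open>Since \<open>fset\<close> is extensional, this is the type of hereditarily finite sets.\<close>

datatype game = Game (options: "game fset")

lemma size_option [termination_simp]: "G' |\<in>| options G \<Longrightarrow> size G' < size G"
proof (cases G)
  case (Game S)
  assume "G' |\<in>| options G"
  then have *: "G' \<in> fset S" using Game by simp
  have "Suc (size G') \<le> (\<Sum>g\<in>fset S. Suc (size g))"
    using * by (intro member_le_sum) auto
  then show ?thesis using Game by simp
qed

instantiation game :: comm_monoid_add
begin

definition zero_game :: game where
  "zero_game = Game {||}"

function plus_game :: "game \<Rightarrow> game \<Rightarrow> game" where
  "plus_game G H =
     Game ((\<lambda>G'. plus_game G' H) |`| options G |\<union>| (\<lambda>H'. plus_game G H') |`| options H)"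
  by pat_completeness auto
termination
  by (relation "measure (\<lambda>(G, H). size G + size H)") (auto simp: size_option)

declare plus_game.simps [simp del]

instance
proof
  fix a b c :: game
  show "a + b + c = a + (b + c)"
  proof (induction "size a + size b + size c" arbitrary: a b c rule: less_induct)
    case less
    have o: "options (x + y) = (\<lambda>x'. x' + y) |`| options x |\<union>| (\<lambda>y'. x + y') |`| options y"
      for x y :: game by (subst plus_game.simps) simp
    have 1: "a' + b + c = a' + (b + c)" if "a' |\<in>| options a" for a'
      by (rule less) (use size_option[OF that] in simp)
    have 2: "a + b' + c = a + (b' + c)" if "b' |\<in>| options b" for b'
      by (rule less) (use size_option[OF that] in simp)
    have 3: "a + b + c' = a + (b + c')" if "c' |\<in>| options c" for c'
      by (rule less) (use size_option[OF that] in simp)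
    have "(\<lambda>a'. a' + b + c) |`| options a = (\<lambda>a'. a' + (b + c)) |`| options a"
         "(\<lambda>b'. a + b' + c) |`| options b = (\<lambda>b'. a + (b' + c)) |`| options b"
         "(\<lambda>c'. a + b + c') |`| options c = (\<lambda>c'. a + (b + c')) |`| options c"
      using 1 2 3 by (intro fset.map_cong0; simp)+
    then have "options (a + b + c) = options (a + (b + c))"
      unfolding o[of "a + b" c] o[of a b] o[of a "b + c"] o[of b c]
      by (simp only: fimage_funion fset.map_comp comp_def sup_assoc)
    then show ?case by (metis game.collapse)
  qed
  show "a + b = b + a"
  proof (induction "size a + size b" arbitrary: a b rule: less_induct)
    case less
    have 1: "a' + b = b + a'" if "a' |\<in>| options a" for a'
      by (rule less) (use size_option[OF that] in simp)
    have 2: "a + b' = b' + a" if "b' |\<in>| options b" for b'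
      by (rule less) (use size_option[OF that] in simp)
    have "(\<lambda>a'. a' + b) |`| options a = (\<lambda>a'. b + a') |`| options a"
         "(\<lambda>b'. a + b') |`| options b = (\<lambda>b'. b' + a) |`| options b"
      using 1 2 by (intro fset.map_cong0; simp)+
    then show ?case by (simp add: plus_game.simps[of a b] plus_game.simps[of b a] sup_commute)
  qed
  show "0 + a = a"
  proof (induction a)
    case (Game S)
    have "(\<lambda>a. 0 + a) |`| S = (\<lambda>a. a) |`| S"
      using Game by (intro fset.map_cong0) simp
    then show ?case by (subst plus_game.simps) (simp add: zero_game_def)
  qed
qed

end

text \<open>Misere outcome; an N-position is one that is not a P-position.\<close>

function P_position :: "game \<Rightarrow> bool" where
  "P_position G \<longleftrightarrow> G \<noteq> 0 \<and> (\<forall>G'. G' |\<in>| options G \<longrightarrow> \<not> P_position G')"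
  by pat_completeness auto
termination
  by (relation "measure size") (auto simp: size_option)

function grundy :: "game \<Rightarrow> nat" where
  "grundy G = (LEAST n. n \<notin> grundy ` fset (options G))"
  by pat_completeness auto
termination
  by (relation "measure size") (auto simp: size_option)

declare P_position.simps [simp del] grundy.simps [simp del]

definition closed_games :: "game set \<Rightarrow> bool" where
  "closed_games A \<longleftrightarrow> 0 \<in> A \<and> (\<forall>G\<in>A. \<forall>G'. G' |\<in>| options G \<longrightarrow> G' \<in> A)
     \<and> (\<forall>G\<in>A. \<forall>H\<in>A. G + H \<in> A)"

definition cl :: "game set \<Rightarrow> game set" where
  "cl S = \<Inter>{A. closed_games A \<and> S \<subseteq> A}"


section \<open>Bipartite monoids and kernels\<close>

record 'a bipartite_monoid = "'a monoid" +
  pset :: "'a set"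

definition bipartite_iso ::
  "('a, 'c) bipartite_monoid_scheme \<Rightarrow> ('b, 'd) bipartite_monoid_scheme \<Rightarrow> bool" where
  "bipartite_iso Q R \<longleftrightarrow>
     (\<exists>h \<in> iso Q R. h \<one>\<^bsub>Q\<^esub> = \<one>\<^bsub>R\<^esub> \<and> h ` pset Q = pset R)"

text \<open>Ideals are required to be nonempty, as otherwise every kernel would be empty. The
  kernel of an infinite monoid may still be empty.\<close>

definition monoid_ideal :: "('a, 'c) monoid_scheme \<Rightarrow> 'a set \<Rightarrow> bool" where
  "monoid_ideal M I \<longleftrightarrow> I \<noteq> {} \<and> I \<subseteq> carrier M \<and> (\<forall>x\<in>carrier M. \<forall>y\<in>I. x \<otimes>\<^bsub>M\<^esub> y \<in> I)"

definition monoid_kernel :: "('a, 'c) monoid_scheme \<Rightarrow> 'a set" where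
  "monoid_kernel M = \<Inter>{I. monoid_ideal M I}"

definition kernel_identity :: "('a, 'c) monoid_scheme \<Rightarrow> 'a" where
  "kernel_identity M =
     (THE z. z \<in> monoid_kernel M \<and> (\<forall>x\<in>monoid_kernel M. z \<otimes>\<^bsub>M\<^esub> x = x))"

text \<open>If the kernel is empty, the right-hand side is false, whatever the description operator
  returns.\<close>

definition normal_bipartite :: "('a, 'c) bipartite_monoid_scheme \<Rightarrow> bool" where
  "normal_bipartite Q \<longleftrightarrow> monoid_kernel Q \<inter> pset Q = {kernel_identity Q}"


section \<open>Misere quotients\<close>

definition indist :: "game set \<Rightarrow> (game \<times> game) set" where
  "indist A = {(G, H). G \<in> A \<and> H \<in> A \<and> (\<forall>X\<in>A. P_position (G + X) \<longleftrightarrow> P_position (H + X))}"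

definition quotient_map :: "game set \<Rightarrow> game \<Rightarrow> game set" where
  "quotient_map A G = indist A `` {G}"

definition misere_quotient :: "game set \<Rightarrow> game set bipartite_monoid" where
  "misere_quotient A =
     \<lparr> carrier = A // indist A,
       mult = (\<lambda>X Y. \<Union>G\<in>X. \<Union>H\<in>Y. quotient_map A (G + H)),
       one = quotient_map A 0,
       pset = quotient_map A ` {G \<in> A. P_position G} \<rparr>"

definition faithful :: "game set \<Rightarrow> bool" where
  "faithful A \<longleftrightarrow>
     (\<forall>G\<in>A. \<forall>H\<in>A. quotient_map A G = quotient_map A H \<longrightarrow> grundy G = grundy H)"

definition faithfully_normal :: "game set \<Rightarrow> bool" where
  "faithfully_normal A \<longleftrightarrow> faithful A \<and> normal_bipartite (misere_quotient A)"

lemma equiv_indist: "equiv A (indist A)"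
  by (rule equivI) (auto simp: indist_def refl_on_def sym_def trans_def)

lemma indist_plus:
  assumes "closed_games A" "(G, G') \<in> indist A" "(H, H') \<in> indist A"
  shows "(G + H, G' + H') \<in> indist A"
proof -
  have A: "X + Y \<in> A" if "X \<in> A" "Y \<in> A" for X Y
    using assms(1) that by (auto simp: closed_games_def)
  have m: "G \<in> A" "G' \<in> A" "H \<in> A" "H' \<in> A"
    using assms by (auto simp: indist_def)
  have "P_position (G + H + X) \<longleftrightarrow> P_position (G' + H' + X)" if "X \<in> A" for X
  proof -
    have "P_position (G + (H + X)) \<longleftrightarrow> P_position (G' + (H + X))"
      using assms(2) A m that by (auto simp: indist_def)
    moreover have "P_position (H + (G' + X)) \<longleftrightarrow> P_position (H' + (G' + X))"
      using assms(3) A m that by (auto simp: indist_def)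
    ultimately show ?thesis by (simp add: ac_simps)
  qed
  then show ?thesis using A m by (auto simp: indist_def)
qed

lemma mult_misere_quotient:
  assumes "closed_games A" "G \<in> A" "H \<in> A"
  shows "quotient_map A G \<otimes>\<^bsub>misere_quotient A\<^esub> quotient_map A H = quotient_map A (G + H)"
proof -
  have eq: "quotient_map A (G' + H') = quotient_map A (G + H)"
    if "G' \<in> quotient_map A G" "H' \<in> quotient_map A H" for G' H'
    unfolding quotient_map_def
    by (rule equiv_class_eq[OF equiv_indist, symmetric], rule indist_plus)
      (use assms that in \<open>auto simp: quotient_map_def\<close>)
  have "G \<in> quotient_map A G" "H \<in> quotient_map A H"
    using assms by (auto simp: quotient_map_def indist_def)
  then have "(\<Union>G'\<in>quotient_map A G. \<Union>H'\<in>quotient_map A H. quotient_map A (G' + H'))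
      = quotient_map A (G + H)"
    using eq by blast
  then show ?thesis by (simp add: misere_quotient_def)
qed


section \<open>Tame extensions\<close>

text \<open>All the iterated extensions of one bipartite monoid live on the following type. The
  extension that leads from the \<open>n\<close>-th to the \<open>Suc n\<close>-th iterate uses the formal symbols
  \<open>Bar n x\<close>; the label keeps them apart from the symbols added at earlier stages, so that
  the iterates form a chain of literal inclusions.\<close>

datatype 'a tame = Base (unbase: 'a) | Bar nat (unbar: "'a tame")

definition tame_base :: "'a bipartite_monoid \<Rightarrow> 'a tame bipartite_monoid" where
  "tame_base Q =
     \<lparr> carrier = Base ` carrier Q,
       mult = (\<lambda>x y. Base (unbase x \<otimes>\<^bsub>Q\<^esub> unbase y)),
       one = Base \<one>\<^bsub>Q\<^esub>,
       pset = Base ` pset Q \<rparr>"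

definition tame_extension :: "nat \<Rightarrow> 'a tame bipartite_monoid \<Rightarrow> 'a tame bipartite_monoid" where
  "tame_extension n Q =
     \<lparr> carrier = carrier Q \<union> Bar n ` monoid_kernel Q,
       mult = (\<lambda>x y.
         if x \<in> carrier Q
         then if y \<in> carrier Q then x \<otimes>\<^bsub>Q\<^esub> y else Bar n (x \<otimes>\<^bsub>Q\<^esub> unbar y)
         else if y \<in> carrier Q then Bar n (unbar x \<otimes>\<^bsub>Q\<^esub> y) else unbar x \<otimes>\<^bsub>Q\<^esub> unbar y),
       one = \<one>\<^bsub>Q\<^esub>,
       pset = pset Q \<rparr>"

primrec tame_iterate :: "nat \<Rightarrow> 'a bipartite_monoid \<Rightarrow> 'a tame bipartite_monoid" where
  "tame_iterate 0 Q = tame_base Q"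
| "tame_iterate (Suc n) Q = tame_extension n (tame_iterate n Q)"

text \<open>In the union of the chain, a product is computed in the first iterate containing both
  factors; the later iterates extend its multiplication.\<close>

definition tame_limit :: "'a bipartite_monoid \<Rightarrow> 'a tame bipartite_monoid" where
  "tame_limit Q =
     \<lparr> carrier = (\<Union>n. carrier (tame_iterate n Q)),
       mult = (\<lambda>x y.
         let n = (LEAST n. x \<in> carrier (tame_iterate n Q) \<and> y \<in> carrier (tame_iterate n Q))
         in x \<otimes>\<^bsub>tame_iterate n Q\<^esub> y),
       one = \<one>\<^bsub>tame_iterate 0 Q\<^esub>,
       pset = (\<Union>n. pset (tame_iterate n Q)) \<rparr>"

fun tame_power :: "enat \<Rightarrow> 'a bipartite_monoid \<Rightarrow> 'a tame bipartite_monoid" where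
  "tame_power (enat n) Q = tame_iterate n Q"
| "tame_power \<infinity> Q = tame_limit Q"

text \<open>The formal symbols added at each stage are fresh.\<close>

lemma Bar_fresh:
  assumes "n \<le> m"
  shows "Bar m x \<notin> carrier (tame_iterate n Q)"
  using assms by (induction n) (auto simp: tame_base_def tame_extension_def)


section \<open>Octal games\<close>

text \<open>The code \<open>d\<^sub>0.d\<^sub>1d\<^sub>2\<dots>d\<^sub>k\<close> is the list of its digits, so \<open>k\<close> is one less than the
  length. The last conjunct is what makes every heap a well-founded game: if \<open>d\<^sub>0\<close> had the
  bit of value 2, every nonempty heap would be an option of itself.\<close>

definition octal_code :: "nat list \<Rightarrow> bool" where
  "octal_code \<Gamma> \<longleftrightarrow> \<Gamma> \<noteq> [] \<and> (\<forall>c\<in>set \<Gamma>. c \<le> 7) \<and> last \<Gamma> \<noteq> 0 \<and> \<not> bit (\<Gamma> ! 0) 1"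

definition last_index :: "nat list \<Rightarrow> nat" where
  "last_index \<Gamma> = length \<Gamma> - 1"

text \<open>The positions reached by a move from a heap of size \<open>h\<close>, as lists of heap sizes. The
  digit bits of value 1, 2, 4 are those numbered 0, 1, 2.\<close>

definition octal_moves :: "nat list \<Rightarrow> nat \<Rightarrow> nat list set" where
  "octal_moves \<Gamma> h = {hs. \<exists>j \<le> min (last_index \<Gamma>) h.
      bit (\<Gamma> ! j) 0 \<and> j = h \<and> hs = []
    \<or> bit (\<Gamma> ! j) 1 \<and> h - j \<ge> 1 \<and> hs = [h - j]
    \<or> bit (\<Gamma> ! j) 2 \<and> (\<exists>a b. a \<ge> 1 \<and> b \<ge> 1 \<and> a + b = h - j \<and> hs = [a, b])}"

text \<open>The restriction to moves into smaller heaps is there for termination only; by the lemma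
  \<open>options_heap\<close> below it is void for octal codes.\<close>

function heap :: "nat list \<Rightarrow> nat \<Rightarrow> game" where
  "heap \<Gamma> h = Game (Abs_fset
     ((\<lambda>hs. sum_list (map (\<lambda>a. heap \<Gamma> a) hs)) ` {hs \<in> octal_moves \<Gamma> h. \<forall>a\<in>set hs. a < h}))"
  by pat_completeness auto
termination
  by (relation "measure snd") auto

declare heap.simps [simp del]

lemma octal_moves_less:
  assumes "octal_code \<Gamma>" "hs \<in> octal_moves \<Gamma> h" "a \<in> set hs"
  shows "a < h"
proof -
  obtain j where j: "hs = [h - j] \<and> bit (\<Gamma> ! j) 1 \<and> h - j \<ge> 1 \<or>
      (\<exists>b c. hs = [b, c] \<and> b \<ge> 1 \<and> c \<ge> 1 \<and> b + c = h - j)"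
    using assms(2,3) by (auto simp: octal_moves_def)
  have "j \<noteq> 0" if "bit (\<Gamma> ! j) 1" using assms(1) that unfolding octal_code_def by metis
  then show ?thesis using j assms(3) by auto
qed

lemma finite_octal_moves: "finite (octal_moves \<Gamma> h)"
proof (rule finite_subset)
  show "octal_moves \<Gamma> h \<subseteq> {hs. set hs \<subseteq> {..h} \<and> length hs \<le> 2}"
    by (auto simp: octal_moves_def)
  show "finite {hs. set hs \<subseteq> {..h} \<and> length hs \<le> 2}"
    by (rule finite_lists_length_le) simp
qed

lemma options_heap:
  assumes "octal_code \<Gamma>"
  shows "fset (options (heap \<Gamma> h)) = (\<lambda>hs. \<Sum>a\<leftarrow>hs. heap \<Gamma> a) ` octal_moves \<Gamma> h"
proof -
  have "{hs \<in> octal_moves \<Gamma> h. \<forall>a\<in>set hs. a < h} = octal_moves \<Gamma> h"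
    using octal_moves_less[OF assms] by auto
  then show ?thesis
    by (subst heap.simps) (simp add: Abs_fset_inverse finite_octal_moves)
qed

text \<open>The games of the partial quotient and of the full quotient. The bound is an integer
  since \<open>M = -1\<close> occurs.\<close>

definition partial_positions :: "nat list \<Rightarrow> int \<Rightarrow> game set" where
  "partial_positions \<Gamma> M = cl {heap \<Gamma> n | n. int n \<le> M}"

definition positions :: "nat list \<Rightarrow> game set" where
  "positions \<Gamma> = cl (range (heap \<Gamma>))"

end

theory Submission
  imports Defs
begin

text \<open>
  In a faithfully normal quotient the kernel is an elementary abelian 2-group on which the Grundy
  value is a complete invariant: a game whose class lies in the kernel is a P-position iff its
  Grundy value is 0, as in normal play. From a heap of size at least \<open>2n\<^sub>0 + d\<close> every move
  leaves at least \<open>2n\<^sub>0\<close> tokens in at most two heaps, hence leaves a heap of size at least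
  \<open>n\<^sub>0\<close>; so, by induction, every position that contains a heap of size at least \<open>n\<^sub>0\<close>
  still follows the normal-play rule. Adjoining such positions thus only enlarges the set of
  Grundy values of the kernel, which is closed under nim sums and under passing to smaller
  values, so it is \<open>{0..<2^b}\<close> or everything. Each tame extension doubles it, the new symbol
  \<open>Bar n x\<close> being \<open>x\<close> plus a kernel element of Grundy value \<open>2^(a + n)\<close>.
\<close>

unbundle bit_operations_syntax

section \<open>Nim sums and Grundy values\<close>

lemma xor_nat_div_2: "(a XOR b) div 2 = (a div 2) XOR (b div 2)" for a b :: nat
  by (rule bit_eqI) (simp add: bit_xor_iff flip: bit_Suc)

lemma xor_nat_cancel: "(a XOR b) XOR b = a" for a b :: nat
  by (simp add: xor.assoc)

text \<open>The arithmetic behind a winning nim move. Halving reduces to the case where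
  \<open>m\<close> and \<open>a XOR b\<close> differ only in the last bit, 0 in \<open>m\<close> and
  1 in \<open>a XOR b\<close>; then exactly one of \<open>a\<close>, \<open>b\<close> is odd, and
  changing that summand clears its last bit.\<close>

lemma xor_nat_less_cases:
  fixes a b m :: nat
  assumes "m < a XOR b"
  shows "m XOR b < a \<or> m XOR a < b"
  using assms
proof (induction "a XOR b" arbitrary: a b m rule: less_induct)
  case less
  have odd: "odd (x XOR y) \<longleftrightarrow> odd x \<noteq> odd y" for x y :: nat
    by (simp add: even_xor_iff)
  have lift: "x < y" if "x div 2 < y div 2" for x y :: nat
    using that by linarith
  show ?case
  proof (cases "m div 2 < (a div 2) XOR (b div 2)")
    case True
    have "(a div 2) XOR (b div 2) < a XOR b"
      using less.prems xor_nat_div_2[of a b] by linarith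
    from less.hyps[OF this True] show ?thesis
      using lift unfolding xor_nat_div_2[symmetric] by blast
  next
    case False
    have eq: "m div 2 = (a XOR b) div 2"
      using False less.prems xor_nat_div_2[of a b] by linarith
    have "even m" "odd (a XOR b)"
      using eq less.prems by presburger+
    have "(m XOR b) div 2 = a div 2" "(m XOR a) div 2 = b div 2"
      unfolding xor_nat_div_2 eq by (metis xor.commute xor_nat_cancel)+
    moreover have "odd (m XOR b) = odd b" "odd (m XOR a) = odd a" "odd a \<noteq> odd b"
      using \<open>even m\<close> \<open>odd (a XOR b)\<close> unfolding odd by simp_all
    moreover have "x < y" if "x div 2 = y div 2" "even x" "odd y" for x y :: nat
      using that by presburger
    ultimately show ?thesis by blast
  qed
qed

lemma xor_nat_eq_0_iff: "a XOR b = 0 \<longleftrightarrow> a = b" for a b :: nat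
  using xor_nat_cancel[of a b] by auto

lemma xor_nat_less_power:
  fixes a b :: nat
  assumes "a < 2 ^ n" "b < 2 ^ n"
  shows "a XOR b < 2 ^ n"
  using assms unfolding take_bit_nat_eq_self_iff[symmetric] take_bit_xor by simp

lemma xor_nat_power:
  fixes r :: nat
  assumes "r < 2 ^ n"
  shows "2 ^ n XOR r = 2 ^ n + r"
proof -
  have "\<not> bit r n"
    using assms by (simp add: bit_iff_odd)
  then have "2 ^ n AND r = 0"
    by (intro bit_eqI) (auto simp: bit_simps)
  then show ?thesis
    by (simp add: disjunctive_add_eq_xor)
qed

text \<open>Downward closure makes a proper \<open>V\<close> an initial segment
  \<open>{..<m}\<close>. If \<open>m\<close> lay strictly between \<open>2 ^ n\<close> and
  \<open>2 ^ Suc n\<close>, it would be the nim sum of the members \<open>2 ^ n\<close> and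
  \<open>m - 2 ^ n\<close>.\<close>

lemma xor_closed_down_closed_nat:
  fixes V :: "nat set"
  assumes "0 \<in> V" and "\<And>x y. x \<in> V \<Longrightarrow> y \<in> V \<Longrightarrow> x XOR y \<in> V"
    and "\<And>x y. x \<in> V \<Longrightarrow> y < x \<Longrightarrow> y \<in> V"
  shows "V = UNIV \<or> (\<exists>n. V = {..<2 ^ n})"
proof (cases "V = UNIV")
  case False
  define m where "m = (LEAST m. m \<notin> V)"
  have m: "m \<notin> V" using False unfolding m_def by (metis LeastI UNIV_eq_I)
  have V: "V = {..<m}"
  proof (intro equalityI subsetI)
    fix x assume "x \<in> V"
    then show "x \<in> {..<m}" using m assms(3) by (metis lessThan_iff linorder_neqE_nat)
  next
    fix x assume "x \<in> {..<m}"
    then show "x \<in> V" using not_less_Least unfolding m_def by blast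
  qed
  have "m > 0" using assms(1) m by (cases m) auto
  then obtain n where n: "2 ^ n \<le> m" "m < 2 ^ Suc n"
    using ex_power_ivl1[of 2 m] by auto
  have "m = 2 ^ n"
  proof (rule ccontr)
    assume "m \<noteq> 2 ^ n"
    then have "2 ^ n \<in> V" "m - 2 ^ n \<in> V" "2 ^ n XOR (m - 2 ^ n) = m"
      using n V xor_nat_power[of "m - 2 ^ n" n] by auto
    then show False using assms(2) m by metis
  qed
  then show ?thesis using V by blast
qed simp

section \<open>Options, outcomes and Grundy values of sums\<close>

lemma options_plus: "fset (options (G + H)) = (\<lambda>G'. G' + H) ` fset (options G) \<union> (\<lambda>H'. G + H') ` fset (options H)"
  by (subst plus_game.simps) simp

lemma options_zero: "options 0 = {||}"
  by (simp add: zero_game_def)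

lemma game_eq_0_iff: "G = 0 \<longleftrightarrow> options G = {||}"
  by (cases G) (simp add: zero_game_def)

lemma plus_game_eq_0_iff: "G + H = 0 \<longleftrightarrow> G = 0 \<and> H = 0" for G H :: game
  using options_plus[of G H] by (auto simp: game_eq_0_iff)

lemma P_position_iff: "P_position G \<longleftrightarrow> G \<noteq> 0 \<and> (\<forall>G' \<in> fset (options G). \<not> P_position G')"
  by (subst P_position.simps) auto

lemma not_P_position_0: "\<not> P_position 0"
  by (subst P_position_iff) simp

lemma grundy_option_neq:
  assumes "G' |\<in>| options G"
  shows "grundy G' \<noteq> grundy G"
proof -
  have "\<exists>n. n \<notin> grundy ` fset (options G)"
    by (rule ex_new_if_finite[OF infinite_UNIV_nat]) simp
  then have "(LEAST n. n \<notin> grundy ` fset (options G)) \<notin> grundy ` fset (options G)"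
    by (rule LeastI_ex)
  then have "grundy G \<notin> grundy ` fset (options G)"
    using grundy.simps[of G] by metis
  with assms show ?thesis by (metis imageI)
qed

lemma grundy_less_option:
  assumes "n < grundy G"
  obtains G' where "G' |\<in>| options G" "grundy G' = n"
proof -
  have "n \<in> grundy ` fset (options G)"
    using assms not_less_Least[of n "\<lambda>n. n \<notin> grundy ` fset (options G)"]
    unfolding grundy.simps[of G] by blast
  then show ?thesis using that by auto
qed

lemma grundy_eqI:
  assumes "\<And>G'. G' |\<in>| options G \<Longrightarrow> grundy G' \<noteq> n"
    and "\<And>m. m < n \<Longrightarrow> \<exists>G'. G' |\<in>| options G \<and> grundy G' = m"
  shows "grundy G = n"
  using assms grundy_less_option grundy_option_neq by (metis linorder_neqE_nat)

text \<open>Sprague-Grundy: XOR with a fixed number is injective, so no option has the value of the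
  sum, and \<open>xor_nat_less_cases\<close> supplies an option for every smaller value. Grundy
  values do not depend on the play convention.\<close>

lemma grundy_plus: "grundy (G + H) = grundy G XOR grundy H"
proof (induction "size G + size H" arbitrary: G H rule: less_induct)
  case less
  have 1: "grundy (G' + H) = grundy G' XOR grundy H" if "G' |\<in>| options G" for G'
    by (rule less) (use size_option[OF that] in simp)
  have 2: "grundy (G + H') = grundy G XOR grundy H'" if "H' |\<in>| options H" for H'
    by (rule less) (use size_option[OF that] in simp)
  show ?case
  proof (rule grundy_eqI)
    fix K assume "K |\<in>| options (G + H)"
    then consider G' where "G' |\<in>| options G" "K = G' + H" | H' where "H' |\<in>| options H" "K = G + H'"
      using options_plus[of G H] by auto
    then show "grundy K \<noteq> grundy G XOR grundy H"
      using 1 2 grundy_option_neq by cases (metis xor_nat_cancel xor.commute)+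
  next
    fix m assume "m < grundy G XOR grundy H"
    then consider "m XOR grundy H < grundy G" | "m XOR grundy G < grundy H"
      using xor_nat_less_cases by blast
    then show "\<exists>K. K |\<in>| options (G + H) \<and> grundy K = m"
    proof cases
      case 1
      then obtain G' where "G' |\<in>| options G" "grundy G' = m XOR grundy H"
        by (rule grundy_less_option)
      then show ?thesis
        using options_plus[of G H] \<open>\<And>G'. G' |\<in>| options G \<Longrightarrow> grundy (G' + H) = grundy G' XOR grundy H\<close>
        by (intro exI[of _ "G' + H"]) (auto simp: xor_nat_cancel)
    next
      case 2
      then obtain H' where "H' |\<in>| options H" "grundy H' = m XOR grundy G"
        by (rule grundy_less_option)
      then show ?thesis
        using options_plus[of G H] \<open>\<And>H'. H' |\<in>| options H \<Longrightarrow> grundy (G + H') = grundy G XOR grundy H'\<close>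
        by (intro exI[of _ "G + H'"]) (auto simp: xor_nat_cancel xor.commute[of "grundy G"])
    qed
  qed
qed

lemma grundy_0: "grundy 0 = 0"
  by (rule grundy_eqI) (auto simp: options_zero)

section \<open>Kernels\<close>

lemma monoid_kernel_subset: "monoid_ideal M I \<Longrightarrow> monoid_kernel M \<subseteq> I"
  by (auto simp: monoid_kernel_def)

lemma (in comm_monoid) monoid_ideal_principal:
  assumes "x \<in> carrier G"
  shows "monoid_ideal G ((\<lambda>w. w \<otimes> x) ` carrier G)"
  unfolding monoid_ideal_def
proof (intro conjI ballI)
  fix v y assume "v \<in> carrier G" "y \<in> (\<lambda>w. w \<otimes> x) ` carrier G"
  then obtain w where "w \<in> carrier G" "y = w \<otimes> x" by blast
  with \<open>v \<in> carrier G\<close> assms show "v \<otimes> y \<in> (\<lambda>w. w \<otimes> x) ` carrier G"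
    by (intro image_eqI[of _ _ "v \<otimes> w"]) (auto simp: m_assoc)
qed (use assms in auto)

lemma (in comm_monoid) monoid_kernel_carrier: "monoid_kernel G \<subseteq> carrier G"
  by (rule monoid_kernel_subset) (auto simp: monoid_ideal_def)

lemma monoid_kernel_closed:
  assumes "w \<in> carrier M" "x \<in> monoid_kernel M"
  shows "w \<otimes>\<^bsub>M\<^esub> x \<in> monoid_kernel M"
  using assms by (auto simp: monoid_kernel_def monoid_ideal_def)

text \<open>Every ideal contains some \<open>y\<close>, and the second assumption makes each element
  of \<open>I\<close> a multiple of it. The kernels of concrete monoids are identified this way
  below.\<close>

lemma monoid_kernel_eqI:
  assumes "monoid_ideal M I"
    and "\<And>x y. x \<in> I \<Longrightarrow> y \<in> carrier M \<Longrightarrow> \<exists>w\<in>carrier M. w \<otimes>\<^bsub>M\<^esub> y = x"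
  shows "monoid_kernel M = I"
proof
  show "I \<subseteq> monoid_kernel M"
    unfolding monoid_kernel_def
  proof (intro subsetI InterI)
    fix x J assume "x \<in> I" "J \<in> {I. monoid_ideal M I}"
    then obtain y where "y \<in> J" "y \<in> carrier M" by (auto simp: monoid_ideal_def)
    with \<open>x \<in> I\<close> obtain w where "w \<in> carrier M" "w \<otimes>\<^bsub>M\<^esub> y = x"
      using assms(2) by blast
    with \<open>y \<in> J\<close> \<open>J \<in> _\<close> show "x \<in> J" by (auto simp: monoid_ideal_def)
  qed
qed (use assms(1) in \<open>rule monoid_kernel_subset\<close>)

lemma (in comm_monoid) kernel_identity_eqI:
  assumes "z \<in> monoid_kernel G" "\<And>x. x \<in> monoid_kernel G \<Longrightarrow> z \<otimes> x = x"
  shows "kernel_identity G = z"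
  unfolding kernel_identity_def
proof (rule the_equality)
  fix e assume "e \<in> monoid_kernel G \<and> (\<forall>x\<in>monoid_kernel G. e \<otimes> x = x)"
  then show "e = z"
    using assms monoid_kernel_carrier m_comm by (metis subsetD)
qed (use assms in auto)

text \<open>Shows that the description in \<open>kernel_identity\<close> denotes. The principal
  ideal of \<open>x \<otimes> x\<close> contains the kernel, so
  \<open>x = w \<otimes> (x \<otimes> x)\<close> for some \<open>w\<close>; since every kernel
  element is a multiple of \<open>x\<close>, the element \<open>w \<otimes> x\<close> fixes them
  all.\<close>

lemma (in comm_monoid) kernel_identity_mult:
  assumes "x \<in> monoid_kernel G"
  shows "kernel_identity G \<otimes> x = x"
proof -
  have c: "y \<in> carrier G" if "y \<in> monoid_kernel G" for y
    using that monoid_kernel_carrier by blast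
  have factor: "\<exists>w\<in>carrier G. y = w \<otimes> v" if "y \<in> monoid_kernel G" "v \<in> carrier G" for y v
    using that monoid_kernel_subset[OF monoid_ideal_principal[of v]] by blast
  obtain w where w: "w \<in> carrier G" "x = w \<otimes> (x \<otimes> x)"
    using factor[OF assms, of "x \<otimes> x"] c[OF assms] by auto
  have e: "w \<otimes> x \<in> monoid_kernel G"
    using w assms by (intro monoid_kernel_closed)
  moreover have "w \<otimes> x \<otimes> y = y" if y: "y \<in> monoid_kernel G" for y
  proof -
    obtain v where v: "v \<in> carrier G" "y = v \<otimes> x"
      using factor[OF y] c[OF assms] by blast
    then have "w \<otimes> x \<otimes> y = v \<otimes> (w \<otimes> (x \<otimes> x))"
      using w(1) c[OF assms] by (simp add: m_ac)
    then show ?thesis using w(2) v(2) by simp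
  qed
  ultimately have "kernel_identity G = w \<otimes> x"
    by (rule kernel_identity_eqI)
  then show ?thesis using \<open>\<And>y. y \<in> monoid_kernel G \<Longrightarrow> w \<otimes> x \<otimes> y = y\<close> assms by simp
qed

section \<open>Faithfully normal quotients\<close>

lemma indist_sym: "(G, H) \<in> indist A \<Longrightarrow> (H, G) \<in> indist A"
  and indist_trans: "(G, H) \<in> indist A \<Longrightarrow> (H, K) \<in> indist A \<Longrightarrow> (G, K) \<in> indist A"
  and indist_refl: "G \<in> A \<Longrightarrow> (G, G) \<in> indist A"
  by (auto simp: indist_def)

lemma quotient_map_eq_iff:
  "G \<in> A \<Longrightarrow> H \<in> A \<Longrightarrow> quotient_map A G = quotient_map A H \<longleftrightarrow> (G, H) \<in> indist A"
  unfolding quotient_map_def by (rule eq_equiv_class_iff[OF equiv_indist])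

lemma carrier_misere_quotient: "carrier (misere_quotient A) = quotient_map A ` A"
  by (auto simp: misere_quotient_def quotient_def quotient_map_def)

lemma one_misere_quotient: "\<one>\<^bsub>misere_quotient A\<^esub> = quotient_map A 0"
  by (simp add: misere_quotient_def)

lemma closed_games_0: "closed_games A \<Longrightarrow> 0 \<in> A"
  and closed_games_option: "closed_games A \<Longrightarrow> G \<in> A \<Longrightarrow> G' |\<in>| options G \<Longrightarrow> G' \<in> A"
  and closed_games_plus: "closed_games A \<Longrightarrow> G \<in> A \<Longrightarrow> H \<in> A \<Longrightarrow> G + H \<in> A"
  by (auto simp: closed_games_def)

lemma closed_games_cl: "closed_games (cl S)"
  by (auto simp: cl_def closed_games_def)

lemma subset_cl: "S \<subseteq> cl S"
  by (auto simp: cl_def)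

lemma cl_minimal: "closed_games A \<Longrightarrow> S \<subseteq> A \<Longrightarrow> cl S \<subseteq> A"
  by (auto simp: cl_def)

lemma comm_monoid_misere_quotient:
  assumes "closed_games A"
  shows "comm_monoid (misere_quotient A)"
proof (rule comm_monoidI)
qed (use assms in \<open>auto simp: carrier_misere_quotient one_misere_quotient mult_misere_quotient
       closed_games_0 closed_games_plus ac_simps\<close>)

lemma quotient_map_in_pset_iff:
  assumes "closed_games A" "G \<in> A"
  shows "quotient_map A G \<in> pset (misere_quotient A) \<longleftrightarrow> P_position G"
proof
  assume "quotient_map A G \<in> pset (misere_quotient A)"
  then obtain H where "H \<in> A" "P_position H" "quotient_map A G = quotient_map A H"
    by (auto simp: misere_quotient_def)
  then have "(G, H) \<in> indist A"
    using assms(2) quotient_map_eq_iff by blast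
  then have "P_position (G + 0) \<longleftrightarrow> P_position (H + 0)"
    using closed_games_0[OF assms(1)] unfolding indist_def by blast
  then show "P_position G" using \<open>P_position H\<close> by simp
qed (use assms in \<open>auto simp: misere_quotient_def\<close>)

text \<open>Kernel arguments run on games rather than on classes, since options and Grundy values
  belong to games.\<close>

definition kernel_games :: "game set \<Rightarrow> game set" where
  "kernel_games A = {G \<in> A. quotient_map A G \<in> monoid_kernel (misere_quotient A)}"

lemma kernel_games_subset: "kernel_games A \<subseteq> A"
  by (auto simp: kernel_games_def)

lemma kernel_games_plus:
  assumes "closed_games A" "G \<in> kernel_games A" "X \<in> A"
  shows "G + X \<in> kernel_games A"
proof -
  have "quotient_map A X \<otimes>\<^bsub>misere_quotient A\<^esub> quotient_map A G \<in> monoid_kernel (misere_quotient A)"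
    using assms by (intro monoid_kernel_closed) (auto simp: kernel_games_def carrier_misere_quotient)
  then show ?thesis
    using assms by (simp add: kernel_games_def mult_misere_quotient closed_games_plus add.commute)
qed

lemma quotient_map_kernel_games:
  assumes "closed_games A"
  shows "quotient_map A ` kernel_games A = monoid_kernel (misere_quotient A)"
  using comm_monoid.monoid_kernel_carrier[OF comm_monoid_misere_quotient[OF assms]]
  by (auto simp: kernel_games_def carrier_misere_quotient)

lemma grundy_eq_if_indist: "faithful A \<Longrightarrow> (G, H) \<in> indist A \<Longrightarrow> grundy G = grundy H"
  unfolding faithful_def indist_def using quotient_map_eq_iff[of G A H] by (auto simp: indist_def)

text \<open>\<open>Z\<close> represents the kernel identity, which by normality is the only P-class
  in the kernel. As \<open>Z + Z\<close> and \<open>Z\<close> are indistinguishable, faithfulness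
  gives them equal Grundy values, and that of \<open>Z + Z\<close> is 0.\<close>

lemma faithfully_normal_kernel_identity:
  assumes "closed_games A" "faithfully_normal A"
  obtains Z where "Z \<in> kernel_games A" "P_position Z" "grundy Z = 0"
    and "\<And>G. G \<in> kernel_games A \<Longrightarrow> (G + Z, G) \<in> indist A"
    and "\<And>G. G \<in> kernel_games A \<Longrightarrow> P_position G \<Longrightarrow> (G, Z) \<in> indist A"
proof -
  let ?Q = "misere_quotient A"
  interpret comm_monoid ?Q by (rule comm_monoid_misere_quotient[OF assms(1)])
  have KP: "monoid_kernel ?Q \<inter> pset ?Q = {kernel_identity ?Q}"
    using assms(2) by (simp add: faithfully_normal_def normal_bipartite_def)
  then obtain Z where Z: "Z \<in> kernel_games A" "quotient_map A Z = kernel_identity ?Q"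
    using quotient_map_kernel_games[OF assms(1)] by (metis IntD1 imageE singletonI)
  have ZA: "Z \<in> A" using Z kernel_games_subset by blast
  have P: "P_position Z" using KP Z(2) quotient_map_in_pset_iff[OF assms(1) ZA] by auto
  have 1: "(G + Z, G) \<in> indist A" if G: "G \<in> kernel_games A" for G
  proof -
    have GA: "G \<in> A" using G kernel_games_subset by blast
    have "quotient_map A (G + Z) = quotient_map A G"
      using kernel_identity_mult[of "quotient_map A G"] G Z(2) mult_misere_quotient[OF assms(1) ZA GA]
      by (simp add: kernel_games_def add.commute)
    then show ?thesis using quotient_map_eq_iff closed_games_plus[OF assms(1)] GA ZA by blast
  qed
  have 2: "(G, Z) \<in> indist A" if G: "G \<in> kernel_games A" "P_position G" for G
  proof -
    have GA: "G \<in> A" using G kernel_games_subset by blast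
    have "quotient_map A G \<in> monoid_kernel ?Q \<inter> pset ?Q"
      using G GA quotient_map_in_pset_iff[OF assms(1)] by (auto simp: kernel_games_def)
    then show ?thesis using KP Z(2) quotient_map_eq_iff[OF GA ZA] by auto
  qed
  have "grundy (Z + Z) = grundy Z"
    using 1[OF Z(1)] grundy_eq_if_indist assms(2) unfolding faithfully_normal_def by blast
  then have "grundy Z = 0" by (simp add: grundy_plus)
  with Z P 1 2 show ?thesis by (intro that)
qed

text \<open>A P-position over the kernel is indistinguishable from \<open>Z\<close>, so faithfulness
  gives it Grundy value 0. Conversely, if \<open>G\<close> has value 0, all options of
  \<open>G + Z\<close> are kernel games of nonzero value, hence not P-positions; so
  \<open>G + Z\<close>, and with it \<open>G\<close>, is one.\<close>

lemma P_kernel_games_iff: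
  assumes "closed_games A" "faithfully_normal A" "G \<in> kernel_games A"
  shows "P_position G \<longleftrightarrow> grundy G = 0"
proof -
  obtain Z where Z: "Z \<in> kernel_games A" "P_position Z" "grundy Z = 0"
    "\<And>G. G \<in> kernel_games A \<Longrightarrow> (G + Z, G) \<in> indist A"
    "\<And>G. G \<in> kernel_games A \<Longrightarrow> P_position G \<Longrightarrow> (G, Z) \<in> indist A"
    using faithfully_normal_kernel_identity[OF assms(1,2)] by blast
  have f: "faithful A" using assms(2) by (simp add: faithfully_normal_def)
  have *: "grundy H = 0" if "H \<in> kernel_games A" "P_position H" for H
    using grundy_eq_if_indist[OF f Z(5)[OF that]] Z(3) by simp
  \<comment> \<open>\<open>G\<close> may have options outside the kernel; adding \<open>Z\<close> moves all of them into it.\<close>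
  have "P_position G" if "grundy G = 0"
  proof -
    have o: "K \<in> kernel_games A" if K: "K \<in> fset (options (G + Z))" for K
    proof -
      consider G' where "G' |\<in>| options G" "K = G' + Z" | Z' where "Z' |\<in>| options Z" "K = G + Z'"
        using K unfolding options_plus by blast
      then show ?thesis
      proof cases
        case 1
        then have "G' \<in> A"
          using assms(3) kernel_games_subset closed_games_option[OF assms(1), of G] by blast
        then have "Z + G' \<in> kernel_games A"
          by (rule kernel_games_plus[OF assms(1) Z(1)])
        then show ?thesis using 1 by (simp add: add.commute)
      next
        case 2
        then have "Z' \<in> A"
          using Z(1) kernel_games_subset closed_games_option[OF assms(1), of Z] by blast
        then show ?thesis
          using 2 kernel_games_plus[OF assms(1,3)] by blast
      qed
    qed
    have "grundy (G + Z) = 0" using that Z(3) by (simp add: grundy_plus)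
    then have "\<not> P_position K" if "K \<in> fset (options (G + Z))" for K
      using * o that grundy_option_neq by metis
    moreover have "G + Z \<noteq> 0"
      using Z(2) not_P_position_0 plus_game_eq_0_iff[of G Z] by metis
    ultimately have "P_position (G + Z)" using P_position_iff by blast
    moreover have "P_position (G + Z + 0) \<longleftrightarrow> P_position (G + 0)"
      using Z(4)[OF assms(3)] closed_games_0[OF assms(1)] unfolding indist_def by blast
    ultimately show ?thesis by simp
  qed
  with * assms(3) show ?thesis by blast
qed

text \<open>The games excluded are \<open>0\<close> and the game whose only option is
  \<open>0\<close>. Both violate \<open>P_kernel_games_iff\<close>: the first has Grundy value 0
  without being a P-position, the second is a P-position of nonzero value. This rules out degenerate
  heaps later.\<close>

lemma kernel_games_option_neq_0:
  assumes "closed_games A" "faithfully_normal A" "G \<in> kernel_games A"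
  shows "\<not> fset (options G) \<subseteq> {0}"
proof
  assume "fset (options G) \<subseteq> {0}"
  then consider "options G = {||}" | "options G = {|0|}"
    by (metis bot_fset.rep_eq finsert.rep_eq fset_inject subset_singletonD)
  then show False
  proof cases
    case 1
    then have "G = 0" by (simp add: game_eq_0_iff)
    then show False
      using P_kernel_games_iff[OF assms] grundy_0 not_P_position_0 by blast
  next
    case 2
    then have "P_position G"
      using P_position_iff[of G] not_P_position_0 by (auto simp: game_eq_0_iff)
    then have "grundy G = 0"
      using P_kernel_games_iff[OF assms] by blast
    then show False
      using 2 grundy_option_neq[of 0 G] grundy_0 by simp
  qed
qed

section \<open>Tame extensions as submonoids\<close>

text \<open>Maps out of a tame extension can be defined by recursion on symbols, whereas the
  isomorphism wanted goes into it. Closure of \<open>T\<close> under products is an assumption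
  because \<open>T\<close> is not known to be a monoid beforehand.\<close>

lemma bipartite_iso_inverse:
  assumes "bij_betw h (carrier T) (carrier R)"
    and "\<And>x y. x \<in> carrier T \<Longrightarrow> y \<in> carrier T \<Longrightarrow>
          x \<otimes>\<^bsub>T\<^esub> y \<in> carrier T \<and> h (x \<otimes>\<^bsub>T\<^esub> y) = h x \<otimes>\<^bsub>R\<^esub> h y"
    and "\<one>\<^bsub>T\<^esub> \<in> carrier T" "h \<one>\<^bsub>T\<^esub> = \<one>\<^bsub>R\<^esub>"
    and "pset T \<subseteq> carrier T" "h ` pset T = pset R"
  shows "bipartite_iso R T"
proof -
  let ?k = "inv_into (carrier T) h"
  have inj: "inj_on h (carrier T)" and im: "h ` carrier T = carrier R"
    using assms(1) by (auto simp: bij_betw_def)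
  have k: "?k (h x) = x" if "x \<in> carrier T" for x
    using inv_into_f_f[OF inj that] .
  have "?k (u \<otimes>\<^bsub>R\<^esub> v) = ?k u \<otimes>\<^bsub>T\<^esub> ?k v" if uv: "u \<in> carrier R" "v \<in> carrier R" for u v
  proof -
    obtain x y where "x \<in> carrier T" "y \<in> carrier T" "u = h x" "v = h y"
      using uv im by blast
    then show ?thesis using assms(2)[of x y] k by metis
  qed
  moreover have "bij_betw ?k (carrier R) (carrier T)"
    by (rule bij_betw_inv_into[OF assms(1)])
  ultimately have "?k \<in> iso R T"
    by (auto simp: iso_def hom_def bij_betw_def)
  moreover have "?k \<one>\<^bsub>R\<^esub> = \<one>\<^bsub>T\<^esub>"
    using k assms(3,4) by metis
  moreover have "?k ` pset R = pset T"
    using inv_into_image_cancel[OF inj assms(5)] assms(6) by metis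
  ultimately show ?thesis unfolding bipartite_iso_def by blast
qed

section \<open>Carriers and products of the iterated tame extensions\<close>

lemma pset_tame_iterate: "pset (tame_iterate n Q) = Base ` pset Q"
  and one_tame_iterate: "\<one>\<^bsub>tame_iterate n Q\<^esub> = Base \<one>\<^bsub>Q\<^esub>"
  by (induction n) (auto simp: tame_base_def tame_extension_def)

lemma carrier_tame_iterate_mono: "m \<le> n \<Longrightarrow> carrier (tame_iterate m Q) \<subseteq> carrier (tame_iterate n Q)"
  by (rule lift_Suc_mono_le[of "\<lambda>n. carrier (tame_iterate n Q)"]) (auto simp: tame_extension_def)

lemma Base_in_tame_iterate: "x \<in> carrier Q \<Longrightarrow> Base x \<in> carrier (tame_iterate n Q)"
  using carrier_tame_iterate_mono[of 0 n Q] by (auto simp: tame_base_def)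

lemma carrier_tame_iterate_Suc:
  "carrier (tame_iterate (Suc n) Q) = carrier (tame_iterate n Q) \<union> Bar n ` monoid_kernel (tame_iterate n Q)"
  by (simp add: tame_extension_def)

lemma mult_tame_iterate_Suc:
  assumes "x \<in> carrier (tame_iterate n Q)"
  shows "y \<in> carrier (tame_iterate n Q) \<Longrightarrow>
          x \<otimes>\<^bsub>tame_iterate (Suc n) Q\<^esub> y = x \<otimes>\<^bsub>tame_iterate n Q\<^esub> y"
    and "x \<otimes>\<^bsub>tame_iterate (Suc n) Q\<^esub> Bar n y = Bar n (x \<otimes>\<^bsub>tame_iterate n Q\<^esub> y)"
    and "Bar n y \<otimes>\<^bsub>tame_iterate (Suc n) Q\<^esub> x = Bar n (y \<otimes>\<^bsub>tame_iterate n Q\<^esub> x)"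
    and "Bar n u \<otimes>\<^bsub>tame_iterate (Suc n) Q\<^esub> Bar n v = u \<otimes>\<^bsub>tame_iterate n Q\<^esub> v"
  using assms by (simp_all add: tame_extension_def Bar_fresh)

text \<open>In the application \<open>R\<close> is the quotient of all positions, \<open>Q\<close>
  the partial quotient, \<open>\<iota>\<close> the map induced by the inclusion of games,
  \<open>K\<close> the kernel of \<open>R\<close>, and \<open>g\<close> the Grundy value of a class.
  By \<open>K_inj\<close> and \<open>g_mult\<close>, equations between elements of \<open>K\<close>
  can be checked by nim arithmetic.\<close>

locale tame_embedding = comm_monoid R
  for R :: "'b bipartite_monoid" (structure) +
  fixes Q :: "'a bipartite_monoid" and \<iota> :: "'a \<Rightarrow> 'b" and K :: "'b set" and g :: "'b \<Rightarrow> nat"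
  assumes Q: "comm_monoid Q" and pset_Q: "pset Q \<subseteq> carrier Q"
    and \<iota>_inj: "inj_on \<iota> (carrier Q)"
    and \<iota>_mult: "p \<in> carrier Q \<Longrightarrow> q \<in> carrier Q \<Longrightarrow> \<iota> (p \<otimes>\<^bsub>Q\<^esub> q) = \<iota> p \<otimes> \<iota> q"
    and \<iota>_one: "\<iota> \<one>\<^bsub>Q\<^esub> = \<one>"
    and \<iota>_pset: "\<iota> ` pset Q = pset R"
    and K_mult: "x \<in> K \<Longrightarrow> y \<in> carrier R \<Longrightarrow> x \<otimes> y \<in> K"
    and K_inj: "x \<in> K \<Longrightarrow> y \<in> K \<Longrightarrow> g x = g y \<Longrightarrow> x = y"
    and g_mult: "x \<in> carrier R \<Longrightarrow> y \<in> carrier R \<Longrightarrow> g (x \<otimes> y) = g x XOR g y"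
    and carrier_R: "carrier R = \<iota> ` carrier Q \<union> K"
    and \<iota>_kernel: "p \<in> carrier Q \<Longrightarrow> \<iota> p \<in> K \<longleftrightarrow> p \<in> monoid_kernel Q"
    and kernel_Q: "monoid_kernel Q \<noteq> {}"
begin

text \<open>Stated outside the finite locale because it serves the case in which the kernel of
  \<open>Q\<close> already takes all Grundy values, so that no bound \<open>2 ^ a\<close>
  exists.\<close>

lemma iso_tame_0:
  assumes "K \<subseteq> \<iota> ` carrier Q"
  shows "bipartite_iso R (tame_iterate 0 Q)"
proof (rule bipartite_iso_inverse)
  interpret Q: comm_monoid Q by (rule Q)
  show "bij_betw (\<iota> \<circ> unbase) (carrier (tame_iterate 0 Q)) (carrier R)"
    using assms \<iota>_inj by (auto simp: tame_base_def carrier_R bij_betw_def inj_on_def image_image)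
  show "(\<iota> \<circ> unbase) ` pset (tame_iterate 0 Q) = pset R"
    using \<iota>_pset by (simp add: tame_base_def image_image)
qed (use pset_Q \<iota>_one \<iota>_mult comm_monoid.axioms(1)[OF Q] in
     \<open>auto simp: tame_base_def monoid.m_closed monoid.one_closed\<close>)

end

locale tame_embedding_finite = tame_embedding R Q \<iota> K g
  for R :: "'b bipartite_monoid" (structure) and Q :: "'a bipartite_monoid"
    and \<iota> :: "'a \<Rightarrow> 'b" and K :: "'b set" and g :: "'b \<Rightarrow> nat" +
  fixes a :: nat
  assumes \<iota>_kernel_image: "\<iota> ` monoid_kernel Q = {y \<in> K. g y < 2 ^ a}"
    and g_\<iota>: "p \<in> carrier Q \<Longrightarrow> g (\<iota> p) < 2 ^ a"
begin

text \<open>By \<open>K_inj\<close> the choice is unique if the value \<open>2 ^ (a + n)\<close>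
  occurs on \<open>K\<close>; otherwise it is arbitrary, so the lemmas about it assume that the
  value occurs.\<close>

definition bar_image :: "nat \<Rightarrow> 'b" where
  "bar_image n = (SOME y. y \<in> K \<and> g y = 2 ^ (a + n))"

primrec embed :: "'a tame \<Rightarrow> 'b" where
  "embed (Base x) = \<iota> x"
| "embed (Bar n x) = embed x \<otimes> bar_image n"

text \<open>The expected image of the \<open>n\<close>-th iterate under
  \<open>embed\<close>.\<close>

definition stage :: "nat \<Rightarrow> 'b set" where
  "stage n = \<iota> ` carrier Q \<union> {y \<in> K. g y < 2 ^ (a + n)}"

lemma K_subset: "K \<subseteq> carrier R"
  by (simp add: carrier_R)

lemma stage_subset: "stage n \<subseteq> carrier R"
  by (auto simp: stage_def carrier_R)

lemma g_stage: "y \<in> stage n \<Longrightarrow> g y < 2 ^ (a + n)"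
  unfolding stage_def using g_\<iota>
  by (auto intro: order_less_le_trans[OF _ power_increasing[of a "a + n" "2::nat"]])

text \<open>Each tame extension refers to the kernel of the previous iterate, which therefore has to
  be computed at every stage. For \<open>h x\<close> in \<open>K\<close>, multiplying by
  \<open>h y\<close> twice restores the Grundy value and so \<open>h x\<close> itself; the
  intermediate product lies in the stage because nim sums stay below
  \<open>2 ^ (a + n)\<close>.\<close>

lemma kernel_if_embedded:
  assumes inj: "inj_on h (carrier M)" and im: "h ` carrier M = stage n"
    and mult: "\<And>x y. x \<in> carrier M \<Longrightarrow> y \<in> carrier M \<Longrightarrow>
          x \<otimes>\<^bsub>M\<^esub> y \<in> carrier M \<and> h (x \<otimes>\<^bsub>M\<^esub> y) = h x \<otimes> h y"
  shows "monoid_kernel M = {x \<in> carrier M. h x \<in> K}"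
proof (rule monoid_kernel_eqI)
  have c: "h x \<in> carrier R" if "x \<in> carrier M" for x
    using that im stage_subset by blast
  obtain k where "k \<in> monoid_kernel Q" using kernel_Q by blast
  then have "k \<in> carrier Q"
    using comm_monoid.monoid_kernel_carrier[OF Q] by blast
  then have "\<iota> k \<in> h ` carrier M" "\<iota> k \<in> K"
    using im \<open>k \<in> monoid_kernel Q\<close> \<iota>_kernel by (auto simp: stage_def)
  moreover have "h (x \<otimes>\<^bsub>M\<^esub> y) \<in> K" if "x \<in> carrier M" "y \<in> carrier M" "h y \<in> K" for x y
    using that mult K_mult c m_comm by metis
  ultimately show "monoid_ideal M {x \<in> carrier M. h x \<in> K}"
    using mult by (auto simp: monoid_ideal_def)
  fix x y assume xy: "x \<in> {x \<in> carrier M. h x \<in> K}" "y \<in> carrier M"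
  then have u: "h x \<otimes> h y \<in> K" using K_mult c by blast
  have g: "g (h x \<otimes> h y) = g (h x) XOR g (h y)" using xy c g_mult by blast
  also have "\<dots> < 2 ^ (a + n)"
    using xy im g_stage by (intro xor_nat_less_power) blast+
  finally have "h x \<otimes> h y \<in> h ` carrier M" using u im by (auto simp: stage_def)
  then obtain w where w: "w \<in> carrier M" "h w = h x \<otimes> h y" by force
  have "h x \<otimes> h y \<otimes> h y = h x"
    using u xy c g K_mult by (intro K_inj) (auto simp: g_mult xor_nat_cancel)
  then have "h (w \<otimes>\<^bsub>M\<^esub> y) = h x" using mult w xy(2) by simp
  then have "w \<otimes>\<^bsub>M\<^esub> y = x" using inj mult[OF w(1) xy(2)] xy(1) by (metis inj_onD mem_Collect_eq)
  then show "\<exists>w\<in>carrier M. w \<otimes>\<^bsub>M\<^esub> y = x" using w(1) by blast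
qed

lemma bar_image:
  assumes "2 ^ (a + n) \<in> g ` K"
  shows "bar_image n \<in> K" "g (bar_image n) = 2 ^ (a + n)"
proof -
  have "\<exists>y. y \<in> K \<and> g y = 2 ^ (a + n)" using assms by force
  then show "bar_image n \<in> K" "g (bar_image n) = 2 ^ (a + n)"
    unfolding bar_image_def by (metis (mono_tags, lifting) someI_ex)+
qed

text \<open>Old elements have values below \<open>2 ^ (a + n)\<close>, while \<open>Bar n x\<close>
  gets the value of \<open>x\<close> plus \<open>2 ^ (a + n)\<close>. Hence the two parts of the
  carrier have disjoint images, and the new symbols exhaust the elements of \<open>K\<close> between
  \<open>2 ^ (a + n)\<close> and \<open>2 ^ (a + Suc n)\<close>. The claims are proved together, as
  the kernel at the next step depends on all of them.\<close>

lemma embed_tame_iterate: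
  assumes "\<And>i. i < n \<Longrightarrow> 2 ^ (a + i) \<in> g ` K"
  shows "inj_on embed (carrier (tame_iterate n Q)) \<and>
    embed ` carrier (tame_iterate n Q) = stage n \<and>
    (\<forall>x\<in>carrier (tame_iterate n Q). \<forall>y\<in>carrier (tame_iterate n Q).
       x \<otimes>\<^bsub>tame_iterate n Q\<^esub> y \<in> carrier (tame_iterate n Q) \<and>
       embed (x \<otimes>\<^bsub>tame_iterate n Q\<^esub> y) = embed x \<otimes> embed y)"
  using assms
proof (induction n)
  case 0
  interpret Q: comm_monoid Q by (rule Q)
  have "\<iota> ` carrier Q = stage 0"
    using \<iota>_kernel_image Q.monoid_kernel_carrier by (auto simp: stage_def)
  moreover have "inj_on embed (Base ` carrier Q)"
    using \<iota>_inj by (auto simp: inj_on_def)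
  ultimately show ?case
    using \<iota>_mult by (simp add: tame_base_def image_image)
next
  case (Suc n)
  let ?T = "tame_iterate n Q" and ?T' = "tame_iterate (Suc n) Q"
  let ?b = "bar_image n"
  have hyp: "\<And>i. i < n \<Longrightarrow> 2 ^ (a + i) \<in> g ` K" using Suc.prems by simp
  have inj: "inj_on embed (carrier ?T)" and im: "embed ` carrier ?T = stage n"
    using Suc.IH hyp by blast+
  have mult: "x \<otimes>\<^bsub>?T\<^esub> y \<in> carrier ?T \<and> embed (x \<otimes>\<^bsub>?T\<^esub> y) = embed x \<otimes> embed y"
    if "x \<in> carrier ?T" "y \<in> carrier ?T" for x y
    using Suc.IH hyp that by blast
  have ker: "monoid_kernel ?T = {x \<in> carrier ?T. embed x \<in> K}"
    by (rule kernel_if_embedded[OF inj im mult])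
  have b: "?b \<in> K" "g ?b = 2 ^ (a + n)" using bar_image Suc.prems by blast+
  have bR: "?b \<in> carrier R" using b(1) K_subset by blast
  have eR: "embed x \<in> carrier R" if "x \<in> carrier ?T" for x
    using that im stage_subset by blast
  have small: "g (embed x) < 2 ^ (a + n)" if "x \<in> carrier ?T" for x
    using that im g_stage by blast
  have gb: "g (embed x \<otimes> ?b) = 2 ^ (a + n) + g (embed x)" if "x \<in> carrier ?T" for x
    using that eR bR b(2) small xor_nat_power by (simp add: g_mult xor.commute[of "g (embed x)"])
  have bK: "embed x \<otimes> ?b \<in> K" if "x \<in> monoid_kernel ?T" for x
    using that ker K_mult bR by blast
  \<comment> \<open>Two factors \<open>?b\<close> cancel on \<open>K\<close>, which matches the rule
    that the product of two barred symbols carries no bar.\<close>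
  have BB: "embed x \<otimes> embed y = (embed x \<otimes> ?b) \<otimes> (embed y \<otimes> ?b)"
    if "embed x \<in> K" "embed y \<in> K" for x y
  proof (rule K_inj)
    have "embed x \<in> carrier R" "embed y \<in> carrier R" using that K_subset by blast+
    moreover have "c XOR (c XOR e) = e" for c e :: nat by (simp flip: xor.assoc)
    ultimately show "embed x \<otimes> embed y \<in> K" "embed x \<otimes> ?b \<otimes> (embed y \<otimes> ?b) \<in> K"
      "g (embed x \<otimes> embed y) = g (embed x \<otimes> ?b \<otimes> (embed y \<otimes> ?b))"
      using that K_mult bR by (auto simp: g_mult xor.assoc xor.commute xor.left_commute)
  qed
  have "inj_on embed (Bar n ` monoid_kernel ?T)"
  proof (rule inj_onI)
    fix u v assume "u \<in> Bar n ` monoid_kernel ?T" "v \<in> Bar n ` monoid_kernel ?T"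
      and e: "embed u = embed v"
    then obtain x y where xy: "x \<in> carrier ?T" "y \<in> carrier ?T" "embed x \<in> K" "embed y \<in> K"
      "u = Bar n x" "v = Bar n y" using ker by auto
    then have "g (embed x) = g (embed y)" using e gb[of x] gb[of y] by simp
    then have "x = y" using xy inj K_inj by (metis inj_onD)
    then show "u = v" using xy by simp
  qed
  moreover have "embed x \<noteq> embed (Bar n y)" if "x \<in> carrier ?T" "y \<in> monoid_kernel ?T" for x y
    using small[OF that(1)] gb[of y] that(2) ker by auto
  ultimately have "inj_on embed (carrier ?T')"
    using inj unfolding carrier_tame_iterate_Suc by (auto simp: inj_on_Un simp del: embed.simps)
  moreover have "embed ` carrier ?T' = stage (Suc n)"
  proof
    show "embed ` carrier ?T' \<subseteq> stage (Suc n)"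
    proof
      fix y assume "y \<in> embed ` carrier ?T'"
      then consider "y \<in> stage n" | x where "x \<in> monoid_kernel ?T" "y = embed x \<otimes> ?b"
        unfolding carrier_tame_iterate_Suc image_Un im by auto
      then show "y \<in> stage (Suc n)"
      proof cases
        case 1
        then show ?thesis by (auto simp: stage_def)
      next
        case 2
        then have "x \<in> carrier ?T" using ker by blast
        then have "g y < 2 ^ (a + Suc n)" using gb[of x] small[of x] 2(2) by simp
        then show ?thesis using bK 2 by (simp add: stage_def)
      qed
    qed
    show "stage (Suc n) \<subseteq> embed ` carrier ?T'"
    proof
      fix y assume y: "y \<in> stage (Suc n)"
      show "y \<in> embed ` carrier ?T'"
      proof (cases "y \<in> stage n")
        case True
        then show ?thesis using im unfolding carrier_tame_iterate_Suc by blast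
      next
        case False
        then have yK: "y \<in> K" "2 ^ (a + n) \<le> g y" "g y < 2 ^ (a + Suc n)"
          using y by (auto simp: stage_def not_less)
        have yR: "y \<in> carrier R" using yK K_subset by blast
        \<comment> \<open>An element new at this stage has leading bit \<open>2 ^ (a + n)\<close>.
          Multiplying by \<open>?b\<close> clears it and yields the element of the previous stage
          whose bar maps to \<open>y\<close>; a second multiplication recovers
          \<open>y\<close>.\<close>
        have "g y = 2 ^ (a + n) XOR (g y - 2 ^ (a + n))"
          using yK xor_nat_power[of "g y - 2 ^ (a + n)" "a + n"] by simp
        then have "g (y \<otimes> ?b) = g y - 2 ^ (a + n)"
          using g_mult[OF yR bR] b(2) by (metis xor_nat_cancel xor.commute)
        moreover have "g y - 2 ^ (a + n) < 2 ^ (a + n)"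
          using yK(2,3) by simp
        ultimately have "y \<otimes> ?b \<in> stage n"
          using yK(1) K_mult bR by (simp add: stage_def)
        then obtain x where x: "x \<in> carrier ?T" "embed x = y \<otimes> ?b"
          using im by (metis imageE)
        then have xk: "x \<in> monoid_kernel ?T"
          using yK(1) bR K_mult ker by auto
        have "embed x \<otimes> ?b = y"
          unfolding x(2) using yK(1) yR bR K_mult
          by (intro K_inj) (auto simp: g_mult xor_nat_cancel)
        then have "embed (Bar n x) = y" by simp
        then show ?thesis using xk unfolding carrier_tame_iterate_Suc by blast
      qed
    qed
  qed
  moreover have "\<forall>x\<in>carrier ?T'. \<forall>y\<in>carrier ?T'.
       x \<otimes>\<^bsub>?T'\<^esub> y \<in> carrier ?T' \<and> embed (x \<otimes>\<^bsub>?T'\<^esub> y) = embed x \<otimes> embed y"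
  proof (intro ballI)
    fix x y assume "x \<in> carrier ?T'" "y \<in> carrier ?T'"
    then consider "x \<in> carrier ?T" "y \<in> carrier ?T"
      | y' where "x \<in> carrier ?T" "y' \<in> monoid_kernel ?T" "y = Bar n y'"
      | x' where "y \<in> carrier ?T" "x' \<in> monoid_kernel ?T" "x = Bar n x'"
      | x' y' where "x' \<in> monoid_kernel ?T" "y' \<in> monoid_kernel ?T" "x = Bar n x'" "y = Bar n y'"
      unfolding carrier_tame_iterate_Suc by blast
    then show "x \<otimes>\<^bsub>?T'\<^esub> y \<in> carrier ?T' \<and> embed (x \<otimes>\<^bsub>?T'\<^esub> y) = embed x \<otimes> embed y"
    proof cases
      case 1
      then show ?thesis
        using mult[OF 1] mult_tame_iterate_Suc(1)[OF 1] unfolding carrier_tame_iterate_Suc by simp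
    next
      case 2
      then have y': "y' \<in> carrier ?T" "embed y' \<in> K" using ker by auto
      have "embed x \<otimes> embed y' \<in> K"
        using K_mult[OF y'(2) eR[OF 2(1)]] m_comm[OF eR[OF 2(1)] eR[OF y'(1)]] by simp
      then have "x \<otimes>\<^bsub>?T\<^esub> y' \<in> monoid_kernel ?T" using mult[OF 2(1) y'(1)] ker by simp
      then show ?thesis
        using 2 y' mult[OF 2(1) y'(1)] eR bR mult_tame_iterate_Suc(2)[OF 2(1), of y']
        unfolding carrier_tame_iterate_Suc by (simp add: m_assoc)
    next
      case 3
      then have x': "x' \<in> carrier ?T" "embed x' \<in> K" using ker by auto
      then have "x' \<otimes>\<^bsub>?T\<^esub> y \<in> monoid_kernel ?T"
        using mult[OF x'(1) 3(1)] ker K_mult eR 3(1) by simp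
      then show ?thesis
        using 3 x' mult[OF x'(1) 3(1)] eR bR mult_tame_iterate_Suc(3)[OF 3(1), of x']
        unfolding carrier_tame_iterate_Suc by (simp add: m_ac)
    next
      case 4
      then have k: "x' \<in> carrier ?T" "embed x' \<in> K" "y' \<in> carrier ?T" "embed y' \<in> K"
        using ker by auto
      then show ?thesis
        using 4 mult[OF k(1,3)] BB[OF k(2,4)] mult_tame_iterate_Suc(4)[OF k(1), of x' y']
        unfolding carrier_tame_iterate_Suc by simp
    qed
  qed
  ultimately show ?case by blast
qed

lemma iso_tame_iterate:
  assumes "g ` K = {..<2 ^ (a + n)}"
  shows "bipartite_iso R (tame_iterate n Q)"
proof (rule bipartite_iso_inverse[where h = embed])
  have pow: "2 ^ (a + i) \<in> g ` K" if "i < n" for i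
    unfolding assms using that by simp
  have "K = {y \<in> K. g y < 2 ^ (a + n)}" using assms by blast
  then have "stage n = carrier R" unfolding stage_def carrier_R by simp
  then show "bij_betw embed (carrier (tame_iterate n Q)) (carrier R)"
    using embed_tame_iterate[OF pow] by (simp add: bij_betw_def)
  show "x \<otimes>\<^bsub>tame_iterate n Q\<^esub> y \<in> carrier (tame_iterate n Q) \<and>
      embed (x \<otimes>\<^bsub>tame_iterate n Q\<^esub> y) = embed x \<otimes> embed y"
    if "x \<in> carrier (tame_iterate n Q)" "y \<in> carrier (tame_iterate n Q)" for x y
    using embed_tame_iterate[OF pow] that by blast
qed (use pset_Q \<iota>_one \<iota>_pset monoid.one_closed[OF comm_monoid.axioms(1)[OF Q]] in
     \<open>auto simp: pset_tame_iterate one_tame_iterate Base_in_tame_iterate image_image\<close>)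

text \<open>All powers of two occur as values, so every finite stage embeds. An element
  \<open>y\<close> of \<open>K\<close> appears no later than stage \<open>g y\<close>, because
  \<open>g y < 2 ^ g y\<close>.\<close>

lemma iso_tame_limit:
  assumes "g ` K = UNIV"
  shows "bipartite_iso R (tame_limit Q)"
proof (rule bipartite_iso_inverse[where h = embed])
  let ?C = "\<lambda>n. carrier (tame_iterate n Q)"
  have pow: "2 ^ (a + i) \<in> g ` K" for i using assms by simp
  have "inj_on embed (\<Union>n. ?C n)"
  proof (rule inj_onI)
    fix x y assume "x \<in> (\<Union>n. ?C n)" "y \<in> (\<Union>n. ?C n)" and e: "embed x = embed y"
    then obtain m n where "x \<in> ?C m" "y \<in> ?C n" by blast
    then have "x \<in> ?C (max m n)" "y \<in> ?C (max m n)"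
      using carrier_tame_iterate_mono[of m "max m n" Q] carrier_tame_iterate_mono[of n "max m n" Q]
      by auto
    then show "x = y" using embed_tame_iterate[OF pow] e by (metis inj_onD)
  qed
  moreover have "(\<Union>n. stage n) = carrier R"
  proof
    show "carrier R \<subseteq> (\<Union>n. stage n)"
    proof
      fix y assume "y \<in> carrier R"
      moreover have "g y < 2 ^ (a + g y)"
        by (rule less_le_trans[OF less_exp]) simp
      ultimately have "y \<in> stage (g y)" by (auto simp: carrier_R stage_def)
      then show "y \<in> (\<Union>n. stage n)" by blast
    qed
  qed (use stage_subset in blast)
  ultimately show "bij_betw embed (carrier (tame_limit Q)) (carrier R)"
    using embed_tame_iterate[OF pow] by (simp add: bij_betw_def tame_limit_def image_UN)
  fix x y assume "x \<in> carrier (tame_limit Q)" "y \<in> carrier (tame_limit Q)"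
  then obtain m n where "x \<in> ?C m" "y \<in> ?C n" by (auto simp: tame_limit_def)
  then have "x \<in> ?C (max m n) \<and> y \<in> ?C (max m n)"
    using carrier_tame_iterate_mono[of m "max m n" Q] carrier_tame_iterate_mono[of n "max m n" Q]
    by auto
  \<comment> \<open>Products in the limit are computed in the least common iterate, so both factors
    must be known to lie in that one.\<close>
  then have l: "x \<in> ?C (LEAST n. x \<in> ?C n \<and> y \<in> ?C n) \<and> y \<in> ?C (LEAST n. x \<in> ?C n \<and> y \<in> ?C n)"
    by (rule LeastI[where P = "\<lambda>n. x \<in> ?C n \<and> y \<in> ?C n"])
  define k where "k = (LEAST n. x \<in> ?C n \<and> y \<in> ?C n)"
  have "x \<otimes>\<^bsub>tame_limit Q\<^esub> y = x \<otimes>\<^bsub>tame_iterate k Q\<^esub> y"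
    by (simp add: tame_limit_def k_def Let_def)
  moreover have "x \<otimes>\<^bsub>tame_iterate k Q\<^esub> y \<in> ?C k \<and>
      embed (x \<otimes>\<^bsub>tame_iterate k Q\<^esub> y) = embed x \<otimes> embed y"
    using embed_tame_iterate[OF pow] l unfolding k_def by blast
  ultimately show "x \<otimes>\<^bsub>tame_limit Q\<^esub> y \<in> carrier (tame_limit Q) \<and>
      embed (x \<otimes>\<^bsub>tame_limit Q\<^esub> y) = embed x \<otimes> embed y"
    by (auto simp: tame_limit_def)
next
  have one: "\<one>\<^bsub>tame_limit Q\<^esub> = Base \<one>\<^bsub>Q\<^esub>"
    by (simp add: tame_limit_def tame_base_def)
  show "\<one>\<^bsub>tame_limit Q\<^esub> \<in> carrier (tame_limit Q)"
    using monoid.one_closed[OF comm_monoid.axioms(1)[OF Q]]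
    unfolding one by (auto simp: tame_limit_def Base_in_tame_iterate)
  show "embed \<one>\<^bsub>tame_limit Q\<^esub> = \<one>"
    using \<iota>_one one by simp
  show "pset (tame_limit Q) \<subseteq> carrier (tame_limit Q)"
    using pset_Q by (auto simp: tame_limit_def pset_tame_iterate intro: Base_in_tame_iterate)
  show "embed ` pset (tame_limit Q) = pset R"
    using \<iota>_pset by (simp add: tame_limit_def pset_tame_iterate image_image)
qed

end

section \<open>Extensions that only enlarge the kernel\<close>

text \<open>In the application \<open>A\<close> generates the partial quotient, \<open>B\<close>
  contains all positions, and \<open>U\<close> is the candidate for the games over the kernel of the
  larger quotient. Options of kernel games of \<open>A\<close> may leave \<open>U\<close>, so
  \<open>U_option\<close> speaks only of the other members; the kernel games are controlled by
  \<open>fn_A\<close>.\<close>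

locale kernel_extension =
  fixes A B U :: "game set"
  assumes closed_A: "closed_games A" and closed_B: "closed_games B"
    and A_subset: "A \<subseteq> B" and U_subset: "U \<subseteq> B" and B_subset: "B \<subseteq> A \<union> U"
    and fn_A: "faithfully_normal A"
    and kernel_subset: "kernel_games A \<subseteq> U"
    and U_plus: "G \<in> U \<Longrightarrow> X \<in> B \<Longrightarrow> G + X \<in> U"
    and U_nonzero: "G \<in> U \<Longrightarrow> G \<notin> kernel_games A \<Longrightarrow> G \<noteq> 0"
    and U_option: "G \<in> U \<Longrightarrow> G \<notin> kernel_games A \<Longrightarrow> G' |\<in>| options G \<Longrightarrow> G' \<in> U"
begin

lemma faithful_A: "faithful A"
  using fn_A by (simp add: faithfully_normal_def)

text \<open>On \<open>kernel_games A\<close> this is \<open>P_kernel_games_iff\<close>. Any other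
  member of \<open>U\<close> is nonzero with all options in \<open>U\<close>, so there the misere
  recursion reads exactly like the normal-play one.\<close>

lemma P_position_iff_grundy: "G \<in> U \<Longrightarrow> P_position G \<longleftrightarrow> grundy G = 0"
proof (induction G rule: measure_induct_rule[of size])
  case (less G)
  show ?case
  proof (cases "G \<in> kernel_games A")
    case True
    then show ?thesis using P_kernel_games_iff closed_A fn_A by blast
  next
    case False
    have "P_position G' \<longleftrightarrow> grundy G' = 0" if "G' |\<in>| options G" for G'
      using less.IH size_option[OF that] U_option[OF less.prems False that] by blast
    then have "P_position G \<longleftrightarrow> (\<forall>G'. G' |\<in>| options G \<longrightarrow> grundy G' \<noteq> 0)"
      using P_position_iff[of G] U_nonzero[OF less.prems False] by auto
    also have "\<dots> \<longleftrightarrow> grundy G = 0"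
      using grundy_option_neq grundy_less_option[of 0 G] by (metis gr0I)
    finally show ?thesis .
  qed
qed

text \<open>For the first claim \<open>G\<close> itself is the test game: \<open>G + G\<close> has
  value 0 and is a P-position, so \<open>H + G\<close>, which lies in \<open>U\<close> even if
  \<open>H\<close> does not, must have value 0 too.\<close>

lemma indist_U_iff:
  assumes "G \<in> U" "H \<in> B"
  shows "(G, H) \<in> indist B \<Longrightarrow> grundy G = grundy H"
    and "H \<in> U \<Longrightarrow> grundy G = grundy H \<Longrightarrow> (G, H) \<in> indist B"
proof -
  have GB: "G \<in> B" using assms U_subset by blast
  show "grundy G = grundy H" if "(G, H) \<in> indist B"
  proof -
    have "P_position (G + G) \<longleftrightarrow> P_position (H + G)"
      using that GB by (auto simp: indist_def)
    moreover have "G + G \<in> U" "H + G \<in> U"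
      using U_plus assms GB by (metis add.commute)+
    ultimately show ?thesis
      using P_position_iff_grundy by (auto simp: grundy_plus xor_nat_eq_0_iff)
  qed
  show "(G, H) \<in> indist B" if "H \<in> U" "grundy G = grundy H"
    using that assms GB U_plus by (auto simp: indist_def P_position_iff_grundy grundy_plus)
qed

text \<open>The new test games separate nothing in \<open>A\<close>: after adding a game outside
  \<open>A\<close> the sums lie in \<open>U\<close>, where the outcome depends only on Grundy
  values, and these agree by faithfulness.\<close>

lemma indist_A_iff:
  assumes "G \<in> A" "H \<in> A"
  shows "(G, H) \<in> indist B \<longleftrightarrow> (G, H) \<in> indist A"
proof
  assume "(G, H) \<in> indist B"
  then show "(G, H) \<in> indist A" using assms A_subset by (auto simp: indist_def)
next
  assume GH: "(G, H) \<in> indist A"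
  then have g: "grundy G = grundy H" using grundy_eq_if_indist faithful_A by blast
  have "P_position (G + X) \<longleftrightarrow> P_position (H + X)" if "X \<in> B" for X
  proof (cases "X \<in> A")
    case True
    then show ?thesis using GH by (auto simp: indist_def)
  next
    case False
    then have "G + X \<in> U" "H + X \<in> U"
      using that B_subset U_plus assms A_subset by (metis UnE add.commute subsetD)+
    then show ?thesis using g by (simp add: P_position_iff_grundy grundy_plus)
  qed
  then show "(G, H) \<in> indist B" using assms A_subset by (auto simp: indist_def)
qed

text \<open>No class from outside the kernel of \<open>A\<close> falls into the new kernel. The
  games \<open>G\<close> and \<open>G + Z\<close> are both indistinguishable from \<open>H\<close>,
  hence from each other, already over \<open>A\<close>; and \<open>G + Z\<close> is a kernel
  game.\<close>

lemma kernel_gamesI: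
  assumes "G \<in> A" "H \<in> U" "(G, H) \<in> indist B"
  shows "G \<in> kernel_games A"
proof -
  obtain Z where Z: "Z \<in> kernel_games A" "grundy Z = 0"
    using faithfully_normal_kernel_identity[OF closed_A fn_A] by blast
  have GZ: "G + Z \<in> kernel_games A"
    using kernel_games_plus[OF closed_A Z(1) assms(1)] by (simp add: add.commute)
  have "grundy H = grundy G"
    using assms(1,2) A_subset indist_U_iff(1)[OF _ _ indist_sym[OF assms(3)]] by blast
  then have "(H, G + Z) \<in> indist B"
    using GZ assms kernel_subset U_subset by (intro indist_U_iff(2)) (auto simp: grundy_plus Z)
  then have "(G, G + Z) \<in> indist B"
    using assms(3) indist_trans by blast
  then have "(G, G + Z) \<in> indist A"
    using indist_A_iff assms(1) GZ kernel_games_subset by blast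
  then show ?thesis
    using GZ assms(1) quotient_map_eq_iff[of G A "G + Z"] kernel_games_subset
    by (auto simp: kernel_games_def)
qed

lemma quotient_map_U_eq_iff:
  assumes "G \<in> U" "H \<in> U"
  shows "quotient_map B G = quotient_map B H \<longleftrightarrow> grundy G = grundy H"
  using assms U_subset quotient_map_eq_iff[of G B H] indist_U_iff[of G H] by blast

text \<open>For \<open>G\<close> in \<open>U\<close> the game \<open>G + Y + Y\<close> has the
  Grundy value of \<open>G\<close> and hence its class, so every class from \<open>U\<close> is a
  multiple of every class.\<close>

lemma kernel_misere_quotient_B: "monoid_kernel (misere_quotient B) = quotient_map B ` U"
proof (rule monoid_kernel_eqI)
  obtain Z where Z: "Z \<in> kernel_games A" "grundy Z = 0"
    using faithfully_normal_kernel_identity[OF closed_A fn_A] by blast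
  then have "Z \<in> U" using kernel_subset by blast
  have "quotient_map B X \<otimes>\<^bsub>misere_quotient B\<^esub> quotient_map B G \<in> quotient_map B ` U"
    if "X \<in> B" "G \<in> U" for X G
    using that U_plus[OF that(2,1)] U_subset
    by (auto simp: mult_misere_quotient[OF closed_B] subsetD add.commute)
  then show "monoid_ideal (misere_quotient B) (quotient_map B ` U)"
    using \<open>Z \<in> U\<close> U_subset by (auto simp: monoid_ideal_def carrier_misere_quotient)
  fix x y assume "x \<in> quotient_map B ` U" "y \<in> carrier (misere_quotient B)"
  then obtain G Y where GY: "G \<in> U" "Y \<in> B" "x = quotient_map B G" "y = quotient_map B Y"
    by (auto simp: carrier_misere_quotient)
  have GYU: "G + Y \<in> U" "G + Y + Y \<in> U" using GY U_plus by blast+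
  have "(G + Y + Y, G) \<in> indist B"
    using GYU GY U_subset by (intro indist_U_iff(2)) (auto simp: grundy_plus xor_nat_cancel)
  then have "quotient_map B (G + Y) \<otimes>\<^bsub>misere_quotient B\<^esub> y = x"
    using GY GYU U_subset quotient_map_eq_iff[of "G + Y + Y" B G]
    by (auto simp: mult_misere_quotient[OF closed_B] subsetD)
  then show "\<exists>w\<in>carrier (misere_quotient B). w \<otimes>\<^bsub>misere_quotient B\<^esub> y = x"
    using GYU U_subset by (auto simp: carrier_misere_quotient)
qed

text \<open>Adding \<open>Z\<close> moves any game into \<open>U\<close> without changing its Grundy
  value, and on \<open>U\<close> the class determines the value. Having value 0, \<open>Z\<close>
  also represents the kernel identity of \<open>B\<close>.\<close>

lemma faithfully_normal_B: "faithfully_normal B"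
  unfolding faithfully_normal_def
proof
  obtain Z where Z: "Z \<in> kernel_games A" "grundy Z = 0"
    using faithfully_normal_kernel_identity[OF closed_A fn_A] by blast
  then have ZU: "Z \<in> U" using kernel_subset by blast
  show "faithful B"
    unfolding faithful_def
  proof (intro ballI impI)
    fix G H assume GH: "G \<in> B" "H \<in> B" "quotient_map B G = quotient_map B H"
    then have "(G, H) \<in> indist B" using quotient_map_eq_iff by blast
    then have "(Z + G, Z + H) \<in> indist B"
      using indist_plus[OF closed_B] indist_refl ZU U_subset by blast
    then have "grundy (Z + G) = grundy (Z + H)"
      using indist_U_iff(1) U_plus[OF ZU] GH(1,2) U_subset by blast
    then show "grundy G = grundy H" by (simp add: grundy_plus Z)
  qed
  interpret comm_monoid "misere_quotient B" by (rule comm_monoid_misere_quotient[OF closed_B])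
  have "kernel_identity (misere_quotient B) = quotient_map B Z"
  proof (rule kernel_identity_eqI)
    fix x assume "x \<in> monoid_kernel (misere_quotient B)"
    then obtain G where G: "G \<in> U" "x = quotient_map B G"
      by (auto simp: kernel_misere_quotient_B)
    have "quotient_map B (Z + G) = quotient_map B G"
      using quotient_map_U_eq_iff[of "Z + G" G] G ZU U_plus U_subset by (auto simp: grundy_plus Z)
    then show "quotient_map B Z \<otimes>\<^bsub>misere_quotient B\<^esub> x = x"
      using G ZU U_subset by (auto simp: mult_misere_quotient[OF closed_B] subsetD)
  qed (use ZU in \<open>simp add: kernel_misere_quotient_B\<close>)
  moreover have "quotient_map B G \<in> pset (misere_quotient B) \<longleftrightarrow> quotient_map B G = quotient_map B Z"
    if "G \<in> U" for G
  proof -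
    have "quotient_map B G \<in> pset (misere_quotient B) \<longleftrightarrow> grundy G = grundy Z"
      using that U_subset quotient_map_in_pset_iff[OF closed_B, of G]
      by (auto simp: P_position_iff_grundy Z)
    also have "\<dots> \<longleftrightarrow> quotient_map B G = quotient_map B Z"
      using quotient_map_U_eq_iff[OF that ZU] by simp
    finally show ?thesis .
  qed
  ultimately show "normal_bipartite (misere_quotient B)"
    using ZU by (auto simp: normal_bipartite_def kernel_misere_quotient_B)
qed

text \<open>An option realizing the smaller value may leave the kernel of \<open>A\<close>; adding
  \<open>Z\<close> brings it back and preserves the value. Outside that kernel options stay in
  \<open>U\<close> anyway.\<close>

lemma grundy_down_closed:
  "n \<in> grundy ` U \<Longrightarrow> m < n \<Longrightarrow> m \<in> grundy ` U"
  "n \<in> grundy ` kernel_games A \<Longrightarrow> m < n \<Longrightarrow> m \<in> grundy ` kernel_games A"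
proof -
  obtain Z where Z: "Z \<in> kernel_games A" "grundy Z = 0"
    using faithfully_normal_kernel_identity[OF closed_A fn_A] by blast
  have K: "m \<in> grundy ` kernel_games A" if "G \<in> kernel_games A" "m < grundy G" for m G
  proof -
    obtain G' where G': "G' |\<in>| options G" "grundy G' = m"
      using grundy_less_option \<open>m < grundy G\<close> by blast
    then have "Z + G' \<in> kernel_games A"
      using kernel_games_plus[OF closed_A Z(1)] closed_games_option[OF closed_A] that(1)
        kernel_games_subset by blast
    moreover have "grundy (Z + G') = m" using G' by (simp add: grundy_plus Z)
    ultimately show ?thesis by blast
  qed
  show "m \<in> grundy ` kernel_games A" if "n \<in> grundy ` kernel_games A" "m < n"
    using that K by blast
  show "m \<in> grundy ` U" if "n \<in> grundy ` U" "m < n"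
  proof -
    obtain G where G: "G \<in> U" "grundy G = n" using \<open>n \<in> _\<close> by blast
    show ?thesis
    proof (cases "G \<in> kernel_games A")
      case True
      then show ?thesis using K G \<open>m < n\<close> kernel_subset by blast
    next
      case False
      obtain G' where "G' |\<in>| options G" "grundy G' = m"
        using grundy_less_option G(2) \<open>m < n\<close> by blast
      then show ?thesis using U_option[OF G(1) False] by blast
    qed
  qed
qed

lemma grundy_U_cases: "grundy ` U = UNIV \<or> (\<exists>n. grundy ` U = {..<2 ^ n})"
  and grundy_kernel_cases: "grundy ` kernel_games A = UNIV \<or> (\<exists>n. grundy ` kernel_games A = {..<2 ^ n})"
proof -
  obtain Z where Z: "Z \<in> kernel_games A" "grundy Z = 0"
    using faithfully_normal_kernel_identity[OF closed_A fn_A] by blast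
  show "grundy ` U = UNIV \<or> (\<exists>n. grundy ` U = {..<2 ^ n})"
  proof (rule xor_closed_down_closed_nat)
    show "0 \<in> grundy ` U" using Z kernel_subset by force
    show "x XOR y \<in> grundy ` U" if "x \<in> grundy ` U" "y \<in> grundy ` U" for x y
      using that U_plus U_subset by (auto simp flip: grundy_plus)
  qed (rule grundy_down_closed)
  show "grundy ` kernel_games A = UNIV \<or> (\<exists>n. grundy ` kernel_games A = {..<2 ^ n})"
  proof (rule xor_closed_down_closed_nat)
    show "0 \<in> grundy ` kernel_games A" using Z by force
    show "x XOR y \<in> grundy ` kernel_games A"
      if "x \<in> grundy ` kernel_games A" "y \<in> grundy ` kernel_games A" for x y
      using that kernel_games_plus[OF closed_A] kernel_games_subset[of A]
      by (auto simp flip: grundy_plus)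
  qed (rule grundy_down_closed)
qed

text \<open>The exponent is read off from the Grundy values. If the kernel of \<open>A\<close> takes
  all of them it is 0; if that kernel has \<open>2 ^ a\<close> values, it is \<open>b - a\<close> or
  infinite according to whether \<open>U\<close> has \<open>2 ^ b\<close> values or all.\<close>

lemma isomorphic_tame_power:
  "\<exists>k. bipartite_iso (misere_quotient B) (tame_power k (misere_quotient A))"
proof -
  let ?Q = "misere_quotient A" and ?R = "misere_quotient B"
  obtain Z where Z: "Z \<in> kernel_games A" "grundy Z = 0"
    using faithfully_normal_kernel_identity[OF closed_A fn_A] by blast
  have faithful_B: "faithful B"
    using faithfully_normal_B by (simp add: faithfully_normal_def)
  \<comment> \<open>Classes are sets of games, so both maps pick representatives. Independence of
    the choice comes from \<open>indist_A_iff\<close> for \<open>\<iota>\<close> and from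
    faithfulness of \<open>B\<close> for \<open>g\<close>.\<close>
  define \<iota> where "\<iota> x = quotient_map B (SOME G. G \<in> x)" for x
  define g where "g x = grundy (SOME G. G \<in> x)" for x
  have some: "(G, SOME H. H \<in> quotient_map C G) \<in> indist C" if "G \<in> C" for G C
    using someI[of "\<lambda>H. H \<in> quotient_map C G" G] that by (simp add: quotient_map_def indist_refl)
  have \<iota>: "\<iota> (quotient_map A G) = quotient_map B G" if "G \<in> A" for G
  proof -
    have "(G, SOME H. H \<in> quotient_map A G) \<in> indist B"
      using some[OF that] indist_A_iff by (auto simp: indist_def)
    then show ?thesis
      unfolding \<iota>_def quotient_map_def by (rule equiv_class_eq[OF equiv_indist, symmetric])
  qed
  have g: "g (quotient_map B G) = grundy G" if "G \<in> B" for G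
    unfolding g_def by (rule grundy_eq_if_indist[OF faithful_B some[OF that], symmetric])
  let ?K = "quotient_map B ` U"
  have gK: "g ` ?K = grundy ` U"
    using g U_subset by (force simp: image_image)
  have kernel_A: "quotient_map A G \<in> monoid_kernel ?Q \<longleftrightarrow> G \<in> kernel_games A" if "G \<in> A" for G
    using that by (simp add: kernel_games_def)
  interpret R: comm_monoid ?R by (rule comm_monoid_misere_quotient[OF closed_B])
  have "tame_embedding ?R ?Q \<iota> ?K g"
  proof (intro tame_embedding.intro tame_embedding_axioms.intro)
    show "comm_monoid ?R" by (rule R.comm_monoid_axioms)
    show "comm_monoid ?Q" by (rule comm_monoid_misere_quotient[OF closed_A])
    show "pset ?Q \<subseteq> carrier ?Q" by (auto simp: misere_quotient_def quotient_def quotient_map_def)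
    show "inj_on \<iota> (carrier ?Q)"
      using A_subset \<iota> indist_A_iff quotient_map_eq_iff
      by (auto simp: inj_on_def carrier_misere_quotient subsetD)
    show "\<iota> (p \<otimes>\<^bsub>?Q\<^esub> q) = \<iota> p \<otimes>\<^bsub>?R\<^esub> \<iota> q" if "p \<in> carrier ?Q" "q \<in> carrier ?Q" for p q
      using that A_subset closed_games_plus[OF closed_A]
      by (auto simp: carrier_misere_quotient mult_misere_quotient closed_A closed_B \<iota> subsetD)
    show "\<iota> \<one>\<^bsub>?Q\<^esub> = \<one>\<^bsub>?R\<^esub>"
      using \<iota> closed_games_0[OF closed_A] by (simp add: one_misere_quotient)
    \<comment> \<open>P-positions outside \<open>A\<close> have Grundy value 0 and hence the class
      of \<open>Z\<close>, so no new P-class arises; this agrees with tame extensions leaving the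
      distinguished subset unchanged.\<close>
    have "quotient_map B X \<in> \<iota> ` pset ?Q" if X: "X \<in> B" "P_position X" for X
    proof (cases "X \<in> A")
      case True
      then show ?thesis using \<iota>[OF True] X(2) by (force simp: misere_quotient_def)
    next
      case False
      then have "X \<in> U" using X B_subset by blast
      moreover have "Z \<in> U" "Z \<in> A" "P_position Z"
        using Z kernel_subset kernel_games_subset P_kernel_games_iff[OF closed_A fn_A] by blast+
      ultimately have "quotient_map B X = \<iota> (quotient_map A Z)"
        using X(2) P_position_iff_grundy quotient_map_U_eq_iff \<iota> by simp
      then show ?thesis using \<open>Z \<in> A\<close> \<open>P_position Z\<close> by (auto simp: misere_quotient_def)
    qed
    then show "\<iota> ` pset ?Q = pset ?R"
      using \<iota> A_subset by (auto simp: misere_quotient_def)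
    show "x \<otimes>\<^bsub>?R\<^esub> y \<in> ?K" if "x \<in> ?K" "y \<in> carrier ?R" for x y
      using that U_plus U_subset
      by (auto simp: carrier_misere_quotient mult_misere_quotient closed_B subsetD)
    show "x = y" if xy: "x \<in> ?K" "y \<in> ?K" and "g x = g y" for x y
    proof -
      obtain G H where "G \<in> U" "H \<in> U" "x = quotient_map B G" "y = quotient_map B H"
        using xy by blast
      moreover from this have "g x = grundy G" "g y = grundy H" using g U_subset by blast+
      ultimately show ?thesis using quotient_map_U_eq_iff \<open>g x = g y\<close> by metis
    qed
    show "g (x \<otimes>\<^bsub>?R\<^esub> y) = g x XOR g y" if "x \<in> carrier ?R" "y \<in> carrier ?R" for x y
      using that closed_games_plus[OF closed_B]
      by (auto simp: carrier_misere_quotient mult_misere_quotient closed_B g grundy_plus)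
    show "carrier ?R = \<iota> ` carrier ?Q \<union> ?K"
    proof -
      have "\<iota> ` carrier ?Q = quotient_map B ` A"
        unfolding carrier_misere_quotient image_image using \<iota> by (intro image_cong) auto
      moreover have "B = A \<union> U" using A_subset U_subset B_subset by blast
      ultimately show ?thesis unfolding carrier_misere_quotient by blast
    qed
    show "\<iota> p \<in> ?K \<longleftrightarrow> p \<in> monoid_kernel ?Q" if "p \<in> carrier ?Q" for p
    proof -
      obtain G where G: "G \<in> A" "p = quotient_map A G"
        using \<open>p \<in> carrier ?Q\<close> by (auto simp: carrier_misere_quotient)
      have "quotient_map B G \<in> ?K \<longleftrightarrow> G \<in> kernel_games A"
      proof
        assume "quotient_map B G \<in> ?K"
        then obtain H where H: "H \<in> U" "quotient_map B G = quotient_map B H" by blast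
        then have "(G, H) \<in> indist B"
          using quotient_map_eq_iff[of G B H] G(1) A_subset U_subset by blast
        then show "G \<in> kernel_games A" using kernel_gamesI G(1) H(1) by blast
      qed (use kernel_subset in blast)
      then show ?thesis using G \<iota> kernel_A by simp
    qed
    show "monoid_kernel ?Q \<noteq> {}" using Z(1) by (auto simp: kernel_games_def)
  qed
  then interpret T: tame_embedding ?R ?Q \<iota> ?K g .
  show ?thesis
    using grundy_kernel_cases
  proof (elim disjE exE)
    assume u: "grundy ` kernel_games A = UNIV"
    \<comment> \<open>Every value taken on \<open>U\<close> is already taken on the kernel of
      \<open>A\<close>, so \<open>U\<close> contributes no new classes.\<close>
    have "quotient_map B G \<in> \<iota> ` carrier ?Q" if G: "G \<in> U" for G
    proof -
      obtain H where H: "H \<in> kernel_games A" "grundy G = grundy H" using u by (metis UNIV_I imageE)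
      then have "H \<in> A" "H \<in> U" using kernel_games_subset kernel_subset by blast+
      then have "quotient_map B G = \<iota> (quotient_map A H)"
        using \<iota> quotient_map_U_eq_iff G H(2) by simp
      then show ?thesis using \<open>H \<in> A\<close> by (auto simp: carrier_misere_quotient)
    qed
    then have "bipartite_iso ?R (tame_power (enat 0) ?Q)"
      using T.iso_tame_0 by auto
    then show ?thesis ..
  next
    fix a :: nat
    assume a: "grundy ` kernel_games A = {..<2 ^ a}"
    interpret T: tame_embedding_finite ?R ?Q \<iota> ?K g a
    proof
      have "\<iota> ` monoid_kernel ?Q = quotient_map B ` kernel_games A"
        unfolding quotient_map_kernel_games[OF closed_A, symmetric] image_image
        using \<iota> kernel_games_subset by (intro image_cong) blast+
      also have "\<dots> = {y \<in> ?K. g y < 2 ^ a}"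
      proof (intro equalityI subsetI)
        fix y assume "y \<in> quotient_map B ` kernel_games A"
        then obtain G where "G \<in> kernel_games A" "y = quotient_map B G" by blast
        then show "y \<in> {y \<in> ?K. g y < 2 ^ a}"
          using a kernel_subset U_subset g by (auto simp: subsetD)
      next
        fix y assume "y \<in> {y \<in> ?K. g y < 2 ^ a}"
        then obtain G where G: "G \<in> U" "y = quotient_map B G" "grundy G < 2 ^ a"
          using g U_subset by (auto simp: subsetD)
        then obtain H where "H \<in> kernel_games A" "grundy G = grundy H" using a by (metis imageE lessThan_iff)
        then show "y \<in> quotient_map B ` kernel_games A"
          using G quotient_map_U_eq_iff kernel_subset by blast
      qed
      finally show "\<iota> ` monoid_kernel ?Q = {y \<in> ?K. g y < 2 ^ a}" .
      show "g (\<iota> p) < 2 ^ a" if "p \<in> carrier ?Q" for p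
      proof -
        obtain G where G: "G \<in> A" "p = quotient_map A G"
          using \<open>p \<in> carrier ?Q\<close> by (auto simp: carrier_misere_quotient)
        \<comment> \<open>The bound holds for all of \<open>A\<close>, not just for kernel games,
          because \<open>Z + G\<close> is a kernel game with the value of \<open>G\<close>.\<close>
        then have "grundy (Z + G) < 2 ^ a"
          using a kernel_games_plus[OF closed_A Z(1)] by blast
        then show ?thesis using G \<iota> g A_subset Z(2) by (auto simp: grundy_plus)
      qed
    qed
    show ?thesis
      using grundy_U_cases
    proof (elim disjE exE)
      assume "grundy ` U = UNIV"
      then have "bipartite_iso ?R (tame_power \<infinity> ?Q)"
        using T.iso_tame_limit gK by simp
      then show ?thesis ..
    next
      fix b :: nat
      assume b: "grundy ` U = {..<2 ^ b}"
      have "{..<2 ^ a} \<subseteq> {..<(2::nat) ^ b}"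
        using a b kernel_subset by (metis image_mono)
      then have "a \<le> b" by simp
      then have "bipartite_iso ?R (tame_power (enat (b - a)) ?Q)"
        using T.iso_tame_iterate[of "b - a"] gK b by simp
      then show ?thesis ..
    qed
  qed
qed

end

section \<open>Octal games\<close>

lemma sum_heaps_option:
  assumes "octal_code \<Gamma>" "G' |\<in>| options (\<Sum>a\<leftarrow>hs. heap \<Gamma> a)"
  shows "\<exists>hs'. G' = (\<Sum>a\<leftarrow>hs'. heap \<Gamma> a)"
  using assms(2)
proof (induction hs arbitrary: G')
  case Nil
  then show ?case by (simp add: options_zero)
next
  case (Cons h hs)
  then have "G' \<in> fset (options (heap \<Gamma> h + (\<Sum>a\<leftarrow>hs. heap \<Gamma> a)))" by simp
  then consider ks where "G' = (\<Sum>a\<leftarrow>ks. heap \<Gamma> a) + (\<Sum>a\<leftarrow>hs. heap \<Gamma> a)"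
    | H' where "H' |\<in>| options (\<Sum>a\<leftarrow>hs. heap \<Gamma> a)" "G' = heap \<Gamma> h + H'"
    unfolding options_plus options_heap[OF assms(1)] by blast
  then show ?case
  proof cases
    case 1
    then show ?thesis by (intro exI[of _ "ks @ hs"]) simp
  next
    case 2
    then obtain ks where "H' = (\<Sum>a\<leftarrow>ks. heap \<Gamma> a)" using Cons.IH by blast
    then show ?thesis using 2 by (intro exI[of _ "h # ks"]) simp
  qed
qed

lemma sum_list_closed:
  assumes "closed_games A" "\<And>a. a \<in> set hs \<Longrightarrow> f a \<in> A"
  shows "(\<Sum>a\<leftarrow>hs. f a) \<in> A"
  using assms(2) by (induction hs) (auto simp: closed_games_0 closed_games_plus assms(1))

text \<open>An explicit form of the closure, so that positions can be sorted by whether they contain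
  a large heap.\<close>

lemma positions_eq:
  assumes "octal_code \<Gamma>"
  shows "positions \<Gamma> = range (\<lambda>hs. \<Sum>a\<leftarrow>hs. heap \<Gamma> a)"
proof
  have "closed_games (range (\<lambda>hs. \<Sum>a\<leftarrow>hs. heap \<Gamma> a))"
    unfolding closed_games_def
  proof (intro conjI ballI allI impI)
    show "0 \<in> range (\<lambda>hs. \<Sum>a\<leftarrow>hs. heap \<Gamma> a)" by (intro image_eqI[of _ _ "[]"]) auto
    fix G H assume "G \<in> range (\<lambda>hs. \<Sum>a\<leftarrow>hs. heap \<Gamma> a)" "H \<in> range (\<lambda>hs. \<Sum>a\<leftarrow>hs. heap \<Gamma> a)"
    then obtain hs ks where "G = (\<Sum>a\<leftarrow>hs. heap \<Gamma> a)" "H = (\<Sum>a\<leftarrow>ks. heap \<Gamma> a)" by blast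
    then show "G + H \<in> range (\<lambda>hs. \<Sum>a\<leftarrow>hs. heap \<Gamma> a)"
      by (intro image_eqI[of _ _ "hs @ ks"]) auto
  qed (use sum_heaps_option[OF assms] in blast)
  moreover have "heap \<Gamma> n = (\<Sum>a\<leftarrow>[n]. heap \<Gamma> a)" for n by simp
  ultimately show "positions \<Gamma> \<subseteq> range (\<lambda>hs. \<Sum>a\<leftarrow>hs. heap \<Gamma> a)"
    unfolding positions_def by (intro cl_minimal) blast+
  have "heap \<Gamma> a \<in> positions \<Gamma>" for a
    unfolding positions_def using subset_cl[of "range (heap \<Gamma>)"] by blast
  moreover have "closed_games (positions \<Gamma>)"
    unfolding positions_def by (rule closed_games_cl)
  ultimately have "(\<Sum>a\<leftarrow>hs. heap \<Gamma> a) \<in> positions \<Gamma>" for hs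
    by (intro sum_list_closed)
  then show "range (\<lambda>hs. \<Sum>a\<leftarrow>hs. heap \<Gamma> a) \<subseteq> positions \<Gamma>"
    by blast
qed

text \<open>At least \<open>2 * n\<close> tokens remain, in at most two heaps. The assumption
  \<open>n > 0\<close> excludes the move that takes the whole heap.\<close>

lemma octal_moves_large:
  assumes "hs \<in> octal_moves \<Gamma> h" "2 * n + last_index \<Gamma> \<le> h" "n > 0"
  shows "\<exists>a\<in>set hs. n \<le> a"
proof -
  obtain j where j: "j \<le> last_index \<Gamma>" "j = h \<or> hs = [h - j] \<or> (\<exists>a b. a + b = h - j \<and> hs = [a, b])"
    using assms(1) unfolding octal_moves_def by auto
  then consider "hs = [h - j]" | a b where "a + b = h - j" "hs = [a, b]"
    using assms(2,3) by fastforce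
  then show ?thesis
    using assms(2,3) j(1) by cases auto
qed

text \<open>At least two tokens remain after removing \<open>j\<close>, enough both for leaving one
  heap and for splitting into two; a digit allowing either would give a move.\<close>

lemma heap_terminal_digits:
  assumes "octal_code \<Gamma>" "heap \<Gamma> h = 0" "last_index \<Gamma> + 2 \<le> h" "j \<le> last_index \<Gamma>"
  shows "\<not> bit (\<Gamma> ! j) 1" "\<not> bit (\<Gamma> ! j) 2"
proof -
  have none: "octal_moves \<Gamma> h = {}"
    using options_heap[OF assms(1), of h] assms(2) by (simp add: options_zero)
  have "[h - j] \<in> octal_moves \<Gamma> h" if "bit (\<Gamma> ! j) 1"
    unfolding octal_moves_def using that assms(3,4) by (auto intro!: exI[of _ j])
  then show "\<not> bit (\<Gamma> ! j) 1" using none by blast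
  have "[1, h - j - 1] \<in> octal_moves \<Gamma> h" if "bit (\<Gamma> ! j) 2"
    unfolding octal_moves_def using that assms(3,4) by (auto intro!: exI[of _ j])
  then show "\<not> bit (\<Gamma> ! j) 2" using none by blast
qed

theorem theorem3p9:
  fixes \<Gamma> :: "nat list" and d n\<^sub>0 :: nat and A :: "game set" and Q :: "game set bipartite_monoid"
  assumes "octal_code \<Gamma>"
    and "d = last_index \<Gamma>"
    and "A = partial_positions \<Gamma> (2 * int n\<^sub>0 + int d - 1)"
    and "Q = misere_quotient A"
    and "faithfully_normal A"
    and "\<And>n. n\<^sub>0 \<le> n \<Longrightarrow> n < 2 * n\<^sub>0 + d \<Longrightarrow> quotient_map A (heap \<Gamma> n) \<in> monoid_kernel Q"
  shows "faithfully_normal (positions \<Gamma>)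
    \<and> (\<exists>k :: enat. bipartite_iso (misere_quotient (positions \<Gamma>)) (tame_power k Q))
    \<and> (\<forall>n\<ge>n\<^sub>0. quotient_map (positions \<Gamma>) (heap \<Gamma> n)
              \<in> monoid_kernel (misere_quotient (positions \<Gamma>)))"
proof -
  define N where "N = 2 * n\<^sub>0 + d"
  define B where "B = positions \<Gamma>"
  \<comment> \<open>The positions with a heap beyond the range of the partial quotient, which form
    an ideal of \<open>B\<close>.\<close>
  define V where "V = {heap \<Gamma> n + Y | n Y. N \<le> n \<and> Y \<in> B}"
  have closed_A: "closed_games A" and closed_B: "closed_games B"
    unfolding assms(3) B_def partial_positions_def positions_def by (rule closed_games_cl)+
  have heap_A: "heap \<Gamma> n \<in> A" if "n < N" for n
    using that subset_cl unfolding assms(3) partial_positions_def N_def by fastforce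
  have heap_B: "heap \<Gamma> n \<in> B" for n
    using subset_cl unfolding B_def positions_def by blast
  have AB: "A \<subseteq> B"
    unfolding assms(3) partial_positions_def
    using closed_B heap_B by (intro cl_minimal) auto
  have kernel_heap: "heap \<Gamma> n \<in> kernel_games A" if "n\<^sub>0 \<le> n" "n < N" for n
    using that assms(4,6) heap_A by (auto simp: kernel_games_def N_def)
  \<comment> \<open>Otherwise \<open>H\<^sub>0\<close>, which is \<open>0\<close> or \<open>{0}\<close>, would lie in the kernel, or \<open>A = {0}\<close>.\<close>
  have n0: "n\<^sub>0 > 0"
  proof (rule ccontr)
    assume "\<not> n\<^sub>0 > 0"
    then have [simp]: "n\<^sub>0 = 0" by simp
    show False
    proof (cases "d = 0")
      case True
      then have "A = cl {}"
        unfolding assms(3) partial_positions_def by simp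
      also have "\<dots> \<subseteq> {0}"
        by (rule cl_minimal) (auto simp: closed_games_def options_zero)
      finally have "Z = 0" if "Z \<in> kernel_games A" for Z
        using that kernel_games_subset by blast
      then show False
        using faithfully_normal_kernel_identity[OF closed_A assms(5)] not_P_position_0 by metis
    next
      case False
      then have "heap \<Gamma> 0 \<in> kernel_games A" by (intro kernel_heap) (auto simp: N_def)
      moreover have "fset (options (heap \<Gamma> 0)) \<subseteq> {0}"
        unfolding options_heap[OF assms(1)] by (auto simp: octal_moves_def)
      ultimately show False
        using kernel_games_option_neq_0[OF closed_A assms(5)] by blast
    qed
  qed
  \<comment> \<open>A terminal large heap would leave only digits that permit taking an entire heap.
    Then \<open>n\<^sub>0\<close> tokens could move at most to \<open>0\<close>, although this heap
    lies over the kernel. Positivity of \<open>n\<^sub>0\<close> gives both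
    \<open>d + 2 \<le> N\<close> and \<open>n\<^sub>0 < N\<close>.\<close>
  have heap_nonzero: "heap \<Gamma> n \<noteq> 0" if "N \<le> n" for n
  proof
    assume "heap \<Gamma> n = 0"
    then have "\<not> bit (\<Gamma> ! j) 1" "\<not> bit (\<Gamma> ! j) 2" if "j \<le> d" for j
      using heap_terminal_digits[OF assms(1), of n j] \<open>N \<le> n\<close> n0 that
      by (auto simp: N_def assms(2))
    then have "octal_moves \<Gamma> n\<^sub>0 \<subseteq> {[]}"
      by (auto simp: octal_moves_def assms(2))
    then have "fset (options (heap \<Gamma> n\<^sub>0)) \<subseteq> {0}"
      unfolding options_heap[OF assms(1)] by auto
    moreover have "heap \<Gamma> n\<^sub>0 \<in> kernel_games A"
      using n0 by (intro kernel_heap) (auto simp: N_def)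
    ultimately show False
      using kernel_games_option_neq_0[OF closed_A assms(5)] by blast
  qed
  have VB: "V \<subseteq> B"
    using closed_B heap_B closed_games_plus by (auto simp: V_def)
  have V_plus: "G + X \<in> V" if "G \<in> V" "X \<in> B" for G X
  proof -
    obtain n Y where "N \<le> n" "Y \<in> B" "G = heap \<Gamma> n + Y" using \<open>G \<in> V\<close> by (auto simp: V_def)
    moreover from this have "Y + X \<in> B" using closed_games_plus[OF closed_B] that(2) by blast
    ultimately show ?thesis unfolding V_def by (auto simp: add.assoc)
  qed
  have BAV: "B \<subseteq> A \<union> V"
  proof
    fix G assume "G \<in> B"
    then obtain hs where hs: "G = (\<Sum>a\<leftarrow>hs. heap \<Gamma> a)"
      unfolding B_def positions_eq[OF assms(1)] by blast
    show "G \<in> A \<union> V"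
    proof (cases "\<exists>a\<in>set hs. N \<le> a")
      case True
      then obtain a where a: "a \<in> set hs" "N \<le> a" by blast
      then have "G = heap \<Gamma> a + (\<Sum>a\<leftarrow>remove1 a hs. heap \<Gamma> a)"
        using hs sum_list_map_remove1[of a hs "heap \<Gamma>"] by simp
      then show ?thesis
        using a(2) sum_list_closed[where f = "heap \<Gamma>" and hs = "remove1 a hs", OF closed_B heap_B] unfolding V_def by blast
    next
      case False
      then show ?thesis
        unfolding hs using heap_A by (intro UnI1 sum_list_closed[OF closed_A]) (meson not_le)
    qed
  qed
  define U where "U = kernel_games A \<union> V"
  have U_plus: "G + X \<in> U" if "G \<in> U" "X \<in> B" for G X
  \<comment> \<open>If neither summand contains a large heap, then \<open>G\<close> is a kernel game
    and \<open>X\<close> lies in \<open>A\<close>, so the ideal property of the kernel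
    applies.\<close>
  proof (cases "G \<in> V \<or> X \<in> V")
    case True
    then show ?thesis
      using V_plus[of G X] V_plus[of X G] that VB AB kernel_games_subset[of A]
      unfolding U_def by (metis UnCI UnE add.commute subsetD)
  next
    case False
    then show ?thesis
      using that BAV kernel_games_plus[OF closed_A] by (auto simp: U_def)
  qed
  have heap_U: "heap \<Gamma> n \<in> U" if "n\<^sub>0 \<le> n" for n
  proof (cases "n < N")
    case True
    then show ?thesis using kernel_heap that by (simp add: U_def)
  next
    case False
    then have "heap \<Gamma> n + 0 \<in> V"
      unfolding V_def using closed_games_0[OF closed_B] not_less by blast
    then show ?thesis by (simp add: U_def)
  qed
  interpret kernel_extension A B U
  proof
    show "U \<subseteq> B" "B \<subseteq> A \<union> U" "kernel_games A \<subseteq> U"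
      using VB AB BAV kernel_games_subset[of A] by (auto simp: U_def)
    fix G assume "G \<in> U" "G \<notin> kernel_games A"
    then obtain n Y where n: "N \<le> n" and Y: "Y \<in> B" and G: "G = heap \<Gamma> n + Y"
      by (auto simp: U_def V_def)
    show "G \<noteq> 0" using heap_nonzero[OF n] G plus_game_eq_0_iff by metis
    fix G' assume "G' |\<in>| options G"
    then consider hs where "hs \<in> octal_moves \<Gamma> n" "G' = (\<Sum>a\<leftarrow>hs. heap \<Gamma> a) + Y"
      | Y' where "Y' |\<in>| options Y" "G' = heap \<Gamma> n + Y'"
      using options_plus[of "heap \<Gamma> n" Y] options_heap[OF assms(1), of n] unfolding G by auto
    then show "G' \<in> U"
    proof cases
      case 1
      \<comment> \<open>The move leaves a heap of size at least \<open>n\<^sub>0\<close>, which is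
        in \<open>U\<close> by \<open>heap_U\<close>; everything else is in \<open>B\<close>, and
        \<open>U\<close> absorbs it.\<close>
      then obtain a where a: "a \<in> set hs" "n\<^sub>0 \<le> a"
        using octal_moves_large[of hs \<Gamma> n n\<^sub>0] n n0 unfolding N_def assms(2) by blast
      have "G' = heap \<Gamma> a + ((\<Sum>a\<leftarrow>remove1 a hs. heap \<Gamma> a) + Y)"
        using 1(2) sum_list_map_remove1[OF a(1), of "heap \<Gamma>"] by (simp add: add.assoc)
      then show ?thesis
        using U_plus[OF heap_U[OF a(2)]] closed_games_plus[OF closed_B _ Y]
          sum_list_closed[where f = "heap \<Gamma>" and hs = "remove1 a hs", OF closed_B heap_B] by simp
    next
      case 2
      then show ?thesis
        using n closed_games_option[OF closed_B Y] by (auto simp: U_def V_def)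
    qed
  qed (use closed_A closed_B AB assms(5) U_plus in auto)
  \<comment> \<open>Claim (iii) follows since the kernel of the full quotient is the image of
    \<open>U\<close>, which contains all heaps from \<open>n\<^sub>0\<close> on.\<close>
  show ?thesis
    using faithfully_normal_B isomorphic_tame_power kernel_misere_quotient_B heap_U
    unfolding assms(4) B_def by blast
qed

end
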